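(* The function $\omega\in\operatorname{Hom}_\Bbbk(\mathcal H_c^{\mathrm{dir}},\Bbbk)$ is the two-sided convolution inverse of $e$: $\omega*e=e*\omega=\epsilon$. Moreover, $\omega=e\circ S$, where $S$ is the antipode of $\mathcal H_c^{\mathrm{dir}}$. Consequently, $\omega$ is multiplicative: $\omega(G_1\sqcup G_2)=\omega(G_1)\omega(G_2)$ for finite quivers $G_1,G_2$. Since $\omega(\emptyset)=1$, the function $\omega:\mathcal H_c^{\mathrm{dir}}\to\Bbbk$ is therefore also a character (unital algebra homomorphism).
   Context: $\Bbbk$ is a field of characteristic zero. A (finite) quiver $G=(V_G,E_G,\rho_G)$ has finite sets $V_G,E_G$ and $\rho_G:E_G\to V_G\times V_G$, where $\rho_G(\varepsilon)=(u,v)$ is written $\varepsilon:u\to v$; parallel edges, directed cycles and tadpoles ($u\to u$) are allowed. Each edge carries a scalar decoration $\beta_\varepsilon\in\Bbbk$, preserved by isomorphisms and kept by edges surviving in subquivers and contractions; $\beta_{\varepsilon,-}=(\beta_\varepsilon-1)/2$. A cut-subquiver $H\preceq G$ has vertex set $V_G$ and any $E_H\subseteq E_G$; the contraction $G/H$ has vertices the connected components of $H$ and edges $E_G\setminus E_H$ with induced incidences (edges inside a component become tadpoles). $\Bbbk\mathcal G_{\mathrm{dir}}$ is the commutative algebra with basis the isomorphism classes of (decorated) finite quivers, product disjoint union, unit $\emptyset$, coproduct $\Delta(G)=\sum_{H\preceq G}H\otimes(G/H)$, counit $\epsilon(G)=1$ if $E_G=\emptyset$ and $0$ otherwise. With $\bullet$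 the one-vertex quiver without edges (a grouplike element), $\mathcal H_c^{\mathrm{dir}}=\Bbbk\mathcal G_{\mathrm{dir}}[\bullet^{-1}]$ (with $\Delta(\bullet^{-1})=\bullet^{-1}\otimes\bullet^{-1}$, $\epsilon(\bullet^{-1})=1$) is a Hopf algebra with antipode $S$. Convolution on $\operatorname{Hom}_\Bbbk(\mathcal H_c^{\mathrm{dir}},\Bbbk)$ is $f*g=m_\Bbbk\circ(f\otimes g)\circ\Delta$. The function $e$: for tadpole-free $G$, $e_0(G)=|\operatorname{LE}(G)|/|V_G|!$ if $G$ has no directed cycle ($\operatorname{LE}(G)$ = linear extensions of the partial order induced by the edges), $e_0(G)=0$ otherwise; in general $e(G)=\bigl(\prod_{\varepsilon\text{ tadpole}}(-\beta_{\varepsilon,-})\bigr)e_0(G_{\mathrm{pruned}})$ with $G_{\mathrm{pruned}}$ obtained by deleting all tadpoles. It is multiplicative with $e(\bullet)=1$ and is extended to a character of $\mathcal H_c^{\mathrm{dir}}$ by $e(\bullet^{-1})=1$. The function $\omega:\mathcal H_c^{\mathrm{dir}}\to\Bbbk$ is defined as the unique ($\Bbbk$-linear) function satisfying $\omega*e=\epsilon$. *)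

theory Defs
  imports Complex_Main "HOL-Library.Poly_Mapping" "HOL-Library.Product_Plus"
begin

section \<open>Decorated quivers\<close>

record ('v, 'e, 'k) quiver =
  verts :: "'v set"
  edges :: "'e set"
  ends :: "'e \<Rightarrow> 'v \<times> 'v"
  decor :: "'e \<Rightarrow> 'k"

definition finite_quiver :: "('v, 'e, 'k) quiver \<Rightarrow> bool" where
  "finite_quiver Q \<longleftrightarrow>
     finite (verts Q) \<and> finite (edges Q) \<and> ends Q ` edges Q \<subseteq> verts Q \<times> verts Q"

text \<open>The values of \<open>ends\<close> and \<open>decor\<close> outside \<open>edges\<close> are irrelevant.\<close>

definition quiver_iso :: "('v, 'e, 'k) quiver \<Rightarrow> ('w, 'f, 'k) quiver \<Rightarrow> bool" where
  "quiver_iso P Q \<longleftrightarrow> (\<exists>f g.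
     bij_betw f (verts P) (verts Q) \<and> bij_betw g (edges P) (edges Q) \<and>
     (\<forall>x\<in>edges P. ends Q (g x) = map_prod f f (ends P x) \<and> decor Q (g x) = decor P x))"

definition empty_quiver :: "('v, 'e, 'k) quiver" where
  "empty_quiver = \<lparr>verts = {}, edges = {}, ends = undefined, decor = undefined\<rparr>"

definition bullet_quiver :: "(unit, 'e, 'k) quiver" where
  "bullet_quiver = \<lparr>verts = {()}, edges = {}, ends = undefined, decor = undefined\<rparr>"

definition disj_union ::
  "('v, 'e, 'k) quiver \<Rightarrow> ('w, 'f, 'k) quiver \<Rightarrow> ('v + 'w, 'e + 'f, 'k) quiver" where
  "disj_union P Q =
     \<lparr>verts = verts P <+> verts Q, edges = edges P <+> edges Q,
      ends = case_sum (map_prod Inl Inl \<circ> ends P) (map_prod Inr Inr \<circ> ends Q),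
      decor = case_sum (decor P) (decor Q)\<rparr>"

definition cut_subquiver :: "('v, 'e, 'k) quiver \<Rightarrow> 'e set \<Rightarrow> ('v, 'e, 'k) quiver" where
  "cut_subquiver Q F = Q\<lparr>edges := F\<rparr>"

text \<open>The set of pairs \<open>(u, v)\<close> joined by at least one edge \<open>u \<rightarrow> v\<close>.\<close>

definition adj :: "('v, 'e, 'k) quiver \<Rightarrow> ('v \<times> 'v) set" where
  "adj Q = ends Q ` edges Q"

definition connectivity :: "('v, 'e, 'k) quiver \<Rightarrow> ('v \<times> 'v) set" where
  "connectivity Q = (adj Q \<union> (adj Q)\<inverse>)\<^sup>* \<inter> verts Q \<times> verts Q"

definition components :: "('v, 'e, 'k) quiver \<Rightarrow> 'v set set" where
  "components Q = verts Q // connectivity Q"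

text \<open>\<open>contract Q F\<close> is the contraction of \<open>Q\<close> by its cut-subquiver with edge set \<open>F\<close>.\<close>

definition contract :: "('v, 'e, 'k) quiver \<Rightarrow> 'e set \<Rightarrow> ('v set, 'e, 'k) quiver" where
  "contract Q F =
     (let H = cut_subquiver Q F; comp = (\<lambda>v. connectivity H `` {v}) in
      \<lparr>verts = components H, edges = edges Q - F,
       ends = map_prod comp comp \<circ> ends Q, decor = decor Q\<rparr>)"


section \<open>The function \<open>e\<close> on quivers\<close>

definition edge_order :: "('v, 'e, 'k) quiver \<Rightarrow> ('v \<times> 'v) set" where
  "edge_order Q = (adj Q)\<^sup>* \<inter> verts Q \<times> verts Q"

definition linear_extensions :: "('v, 'e, 'k) quiver \<Rightarrow> ('v \<times> 'v) set set" where
  "linear_extensions Q = {r. linear_order_on (verts Q) r \<and> edge_order Q \<subseteq> r}"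

definition tadpoles :: "('v, 'e, 'k) quiver \<Rightarrow> 'e set" where
  "tadpoles Q = {x \<in> edges Q. fst (ends Q x) = snd (ends Q x)}"

definition pruned :: "('v, 'e, 'k) quiver \<Rightarrow> ('v, 'e, 'k) quiver" where
  "pruned Q = Q\<lparr>edges := edges Q - tadpoles Q\<rparr>"

text \<open>A directed cycle is a nonempty closed directed walk, so \<open>acyclic\<close> also excludes tadpoles;
  \<open>e0_quiver\<close> is meant for, and only applied to, tadpole-free quivers.\<close>

definition e0_quiver :: "('v, 'e, 'k::field_char_0) quiver \<Rightarrow> 'k" where
  "e0_quiver Q =
     (if acyclic (adj Q) then of_nat (card (linear_extensions Q)) / fact (card (verts Q)) else 0)"

definition beta_minus :: "'k::field_char_0 \<Rightarrow> 'k" where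
  "beta_minus \<beta> = (\<beta> - 1) / 2"

definition e_quiver :: "('v, 'e, 'k::field_char_0) quiver \<Rightarrow> 'k" where
  "e_quiver Q = (\<Prod>x\<in>tadpoles Q. - beta_minus (decor Q x)) * e0_quiver (pruned Q)"


section \<open>Isomorphism invariance\<close>

lemma quiver_isoI:
  assumes "bij_betw f (verts P) (verts Q)" "bij_betw g (edges P) (edges Q)"
    and "\<And>x. x \<in> edges P \<Longrightarrow> ends Q (g x) = map_prod f f (ends P x)"
    and "\<And>x. x \<in> edges P \<Longrightarrow> decor Q (g x) = decor P x"
  shows "quiver_iso P Q"
  using assms unfolding quiver_iso_def by blast

lemma quiver_iso_refl: "quiver_iso Q Q"
  by (rule quiver_isoI[of id _ _ id]) (auto simp: prod.map_id0)

lemma quiver_iso_sym: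
  assumes "finite_quiver P" "quiver_iso P Q"
  shows "quiver_iso Q P"
proof -
  obtain f g where f: "bij_betw f (verts P) (verts Q)" and g: "bij_betw g (edges P) (edges Q)"
    and h: "\<And>x. x \<in> edges P \<Longrightarrow> ends Q (g x) = map_prod f f (ends P x) \<and> decor Q (g x) = decor P x"
    using assms(2) unfolding quiver_iso_def by blast
  let ?f = "inv_into (verts P) f" and ?g = "inv_into (edges P) g"
  have inv: "?f (f v) = v" if "v \<in> verts P" for v
    using f that by (simp add: bij_betw_inv_into_left)
  show ?thesis
  proof (rule quiver_isoI[of ?f _ _ ?g])
    fix y assume y: "y \<in> edges Q"
    define x where "x = ?g y"
    have x: "x \<in> edges P" "g x = y"
      using g y unfolding x_def by (meson bij_betwE bij_betw_inv_into, meson bij_betw_inv_into_right)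
    have "ends P x \<in> verts P \<times> verts P"
      using assms(1) x unfolding finite_quiver_def by blast
    then show "ends P (?g y) = map_prod ?f ?f (ends Q y)"
      using h[OF x(1)] x inv by (cases "ends P x") (auto simp flip: x_def)
    show "decor P (?g y) = decor Q y"
      using h[OF x(1)] x by (auto simp flip: x_def)
  qed (use f g in \<open>auto intro: bij_betw_inv_into\<close>)
qed

lemma quiver_iso_trans:
  assumes "quiver_iso P Q" "quiver_iso Q R"
  shows "quiver_iso P R"
proof -
  obtain f g where f: "bij_betw f (verts P) (verts Q)" and g: "bij_betw g (edges P) (edges Q)"
    and h: "\<And>x. x \<in> edges P \<Longrightarrow> ends Q (g x) = map_prod f f (ends P x) \<and> decor Q (g x) = decor P x"
    using assms(1) unfolding quiver_iso_def by blast
  obtain f' g' where f': "bij_betw f' (verts Q) (verts R)" and g': "bij_betw g' (edges Q) (edges R)"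
    and h': "\<And>x. x \<in> edges Q \<Longrightarrow> ends R (g' x) = map_prod f' f' (ends Q x) \<and> decor R (g' x) = decor Q x"
    using assms(2) unfolding quiver_iso_def by blast
  show ?thesis
  proof (rule quiver_isoI[of "f' \<circ> f" _ _ "g' \<circ> g"])
    fix x assume x: "x \<in> edges P"
    then have "g x \<in> edges Q" using g by (auto simp: bij_betw_def)
    with h[OF x] h'[of "g x"]
    show "ends R ((g' \<circ> g) x) = map_prod (f' \<circ> f) (f' \<circ> f) (ends P x)"
      and "decor R ((g' \<circ> g) x) = decor P x"
      by (auto simp: prod.map_comp)
  qed (use f g f' g' in \<open>auto intro: bij_betw_trans\<close>)
qed

lemma rtrancl_map_prod: "(u, v) \<in> r\<^sup>* \<Longrightarrow> (f u, f v) \<in> (map_prod f f ` r)\<^sup>*"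
  by (induction rule: rtrancl_induct) (force intro: rtrancl.rtrancl_into_rtrancl)+

lemma rtrancl_map_prod_iff:
  assumes "inj_on f V" "r \<subseteq> V \<times> V" "u \<in> V" "v \<in> V"
  shows "(f u, f v) \<in> (map_prod f f ` r)\<^sup>* \<longleftrightarrow> (u, v) \<in> r\<^sup>*"
proof
  let ?f = "inv_into V f"
  have inv: "?f (f x) = x" if "x \<in> V" for x
    using assms(1) that by simp
  have "(\<lambda>p. map_prod ?f ?f (map_prod f f p)) ` r = (\<lambda>p. p) ` r"
    by (rule image_cong) (use assms(2) inv in auto)
  then have "map_prod ?f ?f ` map_prod f f ` r = r"
    by (simp add: image_image)
  then show "(f u, f v) \<in> (map_prod f f ` r)\<^sup>* \<Longrightarrow> (u, v) \<in> r\<^sup>*"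
    using rtrancl_map_prod[of "f u" "f v" _ ?f] inv assms(3,4) by metis
qed (rule rtrancl_map_prod)

lemma acyclic_iff_rtrancl: "acyclic r \<longleftrightarrow> (\<forall>(u, v)\<in>r. (v, u) \<notin> r\<^sup>*)"
  unfolding acyclic_def by (auto dest: rtrancl_into_trancl2 tranclD)

lemma acyclic_map_prod_iff:
  assumes "inj_on f V" "r \<subseteq> V \<times> V"
  shows "acyclic (map_prod f f ` r) \<longleftrightarrow> acyclic r"
proof -
  have "(f v, f u) \<in> (map_prod f f ` r)\<^sup>* \<longleftrightarrow> (v, u) \<in> r\<^sup>*" if "(u, v) \<in> r" for u v
    using rtrancl_map_prod_iff[OF assms] that assms(2) by blast
  then show ?thesis
    unfolding acyclic_iff_rtrancl ball_simps by (auto split: prod.splits)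
qed

lemma adj_subset: "finite_quiver Q \<Longrightarrow> adj Q \<subseteq> verts Q \<times> verts Q"
  by (simp add: finite_quiver_def adj_def)

lemma finite_quiver_cut: "finite_quiver Q \<Longrightarrow> F \<subseteq> edges Q \<Longrightarrow> finite_quiver (cut_subquiver Q F)"
  unfolding finite_quiver_def cut_subquiver_def by (auto intro: finite_subset)

lemma finite_quiver_pruned: "finite_quiver Q \<Longrightarrow> finite_quiver (pruned Q)"
  unfolding finite_quiver_def pruned_def by auto

lemma finite_quiver_disj_union:
  "finite_quiver P \<Longrightarrow> finite_quiver Q \<Longrightarrow> finite_quiver (disj_union P Q)"
  unfolding finite_quiver_def disj_union_def by (auto simp: image_subset_iff)

lemma components_eq: "components Q = (\<lambda>v. connectivity Q `` {v}) ` verts Q"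
  unfolding components_def quotient_def by auto

lemma finite_quiver_contract: "finite_quiver Q \<Longrightarrow> finite_quiver (contract Q F)"
  unfolding finite_quiver_def contract_def Let_def components_eq cut_subquiver_def
  by (auto simp: map_prod_def split: prod.splits)

lemma equiv_connectivity: "equiv (verts Q) (connectivity Q)"
proof -
  have "equiv V (R \<inter> V \<times> V)" if "sym R" "trans R" "refl R" for R :: "('a \<times> 'a) set" and V
  proof (rule equivI)
    show "sym (R \<inter> V \<times> V)" using that(1) unfolding sym_def by blast
    show "trans (R \<inter> V \<times> V)" using that(2) unfolding trans_def by blast
    show "refl_on V (R \<inter> V \<times> V)" using that(3) unfolding refl_on_def by blast
  qed auto
  then show ?thesis
    unfolding connectivity_def
    by (metis refl_rtrancl sym_Un_converse sym_rtrancl trans_rtrancl)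
qed

lemma Image_connectivity_eq_iff:
  "u \<in> verts Q \<Longrightarrow> v \<in> verts Q \<Longrightarrow>
     connectivity Q `` {u} = connectivity Q `` {v} \<longleftrightarrow> (u, v) \<in> connectivity Q"
  using eq_equiv_class_iff[OF equiv_connectivity] by metis

lemma connectivity_map:
  assumes "finite_quiver P" "inj_on f (verts P)" "verts Q = f ` verts P"
    "adj Q = map_prod f f ` adj P" "u \<in> verts P"
  shows "connectivity Q `` {f u} = f ` (connectivity P `` {u})"
proof -
  have s: "adj Q \<union> (adj Q)\<inverse> = map_prod f f ` (adj P \<union> (adj P)\<inverse>)"
    unfolding assms(4) by force
  have sub: "adj P \<union> (adj P)\<inverse> \<subseteq> verts P \<times> verts P"
    using adj_subset[OF assms(1)] by auto
  have "(f u, f v) \<in> connectivity Q \<longleftrightarrow> (u, v) \<in> connectivity P" if "v \<in> verts P" for v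
    using rtrancl_map_prod_iff[OF assms(2) sub assms(5) that] that assms(5)
    unfolding connectivity_def s assms(3) by auto
  moreover have "connectivity Q `` {f u} \<subseteq> f ` verts P" "connectivity P `` {u} \<subseteq> verts P"
    unfolding connectivity_def assms(3) by auto
  ultimately show ?thesis by (auto simp: image_iff subset_iff; blast)
qed

lemma quiver_isoE:
  assumes "quiver_iso P Q"
  obtains f g where "bij_betw f (verts P) (verts Q)" "bij_betw g (edges P) (edges Q)"
    "\<And>x. x \<in> edges P \<Longrightarrow> ends Q (g x) = map_prod f f (ends P x)"
    "\<And>x. x \<in> edges P \<Longrightarrow> decor Q (g x) = decor P x"
    "adj Q = map_prod f f ` adj P"
proof -
  obtain f g where h: "bij_betw f (verts P) (verts Q)" "bij_betw g (edges P) (edges Q)"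
    "\<And>x. x \<in> edges P \<Longrightarrow> ends Q (g x) = map_prod f f (ends P x)"
    "\<And>x. x \<in> edges P \<Longrightarrow> decor Q (g x) = decor P x"
    using assms unfolding quiver_iso_def by blast
  have "edges Q = g ` edges P"
    using h(2) by (simp add: bij_betw_def)
  then have "adj Q = map_prod f f ` adj P"
    unfolding adj_def by (simp add: image_image h(3) cong: image_cong)
  with h that show thesis by blast
qed

lemma contract_iso:
  assumes P: "finite_quiver P" and F: "F \<subseteq> edges P"
    and f: "bij_betw f (verts P) (verts Q)" and g: "bij_betw g (edges P) (edges Q)"
    and h: "\<And>x. x \<in> edges P \<Longrightarrow> ends Q (g x) = map_prod f f (ends P x)"
      "\<And>x. x \<in> edges P \<Longrightarrow> decor Q (g x) = decor P x"
  shows "quiver_iso (cut_subquiver P F) (cut_subquiver Q (g ` F))"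
    and "quiver_iso (contract P F) (contract Q (g ` F))"
proof -
  let ?H = "cut_subquiver P F" and ?K = "cut_subquiver Q (g ` F)"
  have "bij_betw g F (g ` F)"
    using g F by (auto simp: bij_betw_def intro: inj_on_subset)
  then show "quiver_iso ?H ?K"
    by (intro quiver_isoI[of f _ _ g]) (use f h F in \<open>auto simp: cut_subquiver_def\<close>)
  have inj: "inj_on f (verts ?H)" and im: "verts ?K = f ` verts ?H"
    using f by (auto simp: cut_subquiver_def bij_betw_def)
  have adj: "adj ?K = map_prod f f ` adj ?H"
    using h(1) F unfolding adj_def cut_subquiver_def
    by (simp add: image_image subset_iff cong: image_cong)
  have conn: "connectivity ?K `` {f u} = f ` (connectivity ?H `` {u})" if "u \<in> verts P" for u
    by (rule connectivity_map[OF finite_quiver_cut[OF P F] inj im adj])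
      (use that in \<open>simp add: cut_subquiver_def\<close>)
  have sub: "C \<subseteq> verts P" if "C \<in> components ?H" for C
    using that unfolding components_eq connectivity_def cut_subquiver_def by auto
  show "quiver_iso (contract P F) (contract Q (g ` F))"
  proof (rule quiver_isoI[of "image f" _ _ g])
    have "inj_on (image f) (components ?H)"
      using inj sub unfolding inj_on_def cut_subquiver_def
      by (metis (no_types, lifting) f bij_betw_def inj_on_image_eq_iff)
    moreover have "image f ` components ?H = components ?K"
      using conn im unfolding components_eq by (force simp: cut_subquiver_def image_iff)
    ultimately show "bij_betw (image f) (verts (contract P F)) (verts (contract Q (g ` F)))"
      by (simp add: contract_def Let_def bij_betw_def)
    show "bij_betw g (edges (contract P F)) (edges (contract Q (g ` F)))"
      using g F unfolding contract_def Let_def bij_betw_def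
      by (auto simp: inj_on_def) blast
  next
    fix x assume "x \<in> edges (contract P F)"
    then have x: "x \<in> edges P" by (simp add: contract_def Let_def)
    then have "ends P x \<in> verts P \<times> verts P"
      using P by (auto simp: finite_quiver_def)
    then show "ends (contract Q (g ` F)) (g x) = map_prod (image f) (image f) (ends (contract P F) x)"
      using h(1)[OF x] conn by (cases "ends P x") (auto simp: contract_def Let_def)
    show "decor (contract Q (g ` F)) (g x) = decor (contract P F) x"
      using h(2)[OF x] by (simp add: contract_def Let_def)
  qed
qed

lemma linear_order_on_image:
  assumes "inj_on f V" "linear_order_on V r"
  shows "linear_order_on (f ` V) (map_prod f f ` r)"
proof -
  have sub: "r \<subseteq> V \<times> V" and r: "refl_on V r" "trans r" "antisym r" "total_on V r"
    using assms(2) unfolding order_on_defs by auto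
  have "inj_on (map_prod f f) (V \<times> V)"
    using assms(1) by (rule map_prod_inj_on) (rule assms(1))
  then have mem: "(f u, f v) \<in> map_prod f f ` r \<longleftrightarrow> (u, v) \<in> r" if "u \<in> V" "v \<in> V" for u v
    using inj_on_image_mem_iff[of "map_prod f f" "V \<times> V" "(u, v)" r] sub that by simp
  have sub': "map_prod f f ` r \<subseteq> f ` V \<times> f ` V" using sub by auto
  have "trans (map_prod f f ` r)"
  proof (rule transI)
    fix x y z assume *: "(x, y) \<in> map_prod f f ` r" "(y, z) \<in> map_prod f f ` r"
    have "x \<in> f ` V" "y \<in> f ` V" "z \<in> f ` V"
      using subsetD[OF sub' *(1)] subsetD[OF sub' *(2)] by simp_all
    then obtain u v w where "x = f u" "y = f v" "z = f w" and V: "u \<in> V" "v \<in> V" "w \<in> V"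
      by (elim imageE)
    note eqs = \<open>x = f u\<close> \<open>y = f v\<close> \<open>z = f w\<close>
    have "(u, v) \<in> r" "(v, w) \<in> r"
      using * mem[OF V(1,2)] mem[OF V(2,3)] unfolding eqs by simp_all
    from r(2) this have "(u, w) \<in> r" by (rule transD)
    then show "(x, z) \<in> map_prod f f ` r" using mem[OF V(1,3)] unfolding eqs by simp
  qed
  moreover have "antisym (map_prod f f ` r)"
  proof (rule antisymI)
    fix x y assume *: "(x, y) \<in> map_prod f f ` r" "(y, x) \<in> map_prod f f ` r"
    have "x \<in> f ` V" "y \<in> f ` V"
      using subsetD[OF sub' *(1)] by simp_all
    then obtain u v where "x = f u" "y = f v" and V: "u \<in> V" "v \<in> V"
      by (elim imageE)
    note eqs = \<open>x = f u\<close> \<open>y = f v\<close>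
    have "(u, v) \<in> r" "(v, u) \<in> r"
      using * mem[OF V] mem[OF V(2,1)] unfolding eqs by simp_all
    from r(3) this have "u = v" by (rule antisymD)
    then show "x = y" by (simp add: eqs)
  qed
  moreover have "refl_on (f ` V) (map_prod f f ` r)"
    using r(1) mem by (auto simp: refl_on_def)
  moreover have "total_on (f ` V) (map_prod f f ` r)"
  proof (rule total_onI)
    fix x y assume "x \<in> f ` V" "y \<in> f ` V" "x \<noteq> y"
    then obtain u v where "x = f u" "y = f v" "u \<noteq> v" and V: "u \<in> V" "v \<in> V" by (elim imageE) auto
    then show "(x, y) \<in> map_prod f f ` r \<or> (y, x) \<in> map_prod f f ` r"
      using r(4) mem[OF V] mem[OF V(2,1)] unfolding total_on_def by simp
  qed
  ultimately show ?thesis using sub' unfolding order_on_defs by blast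
qed

lemma linear_extensions_eq:
  assumes "finite_quiver Q"
  shows "linear_extensions Q = {r. linear_order_on (verts Q) r \<and> adj Q \<subseteq> r}"
proof -
  have "edge_order Q \<subseteq> r \<longleftrightarrow> adj Q \<subseteq> r" if "linear_order_on (verts Q) r" for r
  proof
    assume "edge_order Q \<subseteq> r"
    then show "adj Q \<subseteq> r" using adj_subset[OF assms] unfolding edge_order_def by auto
  next
    assume a: "adj Q \<subseteq> r"
    have r: "refl_on (verts Q) r" "trans r" using that unfolding order_on_defs by auto
    have "(u, v) \<in> r" if "(u, v) \<in> (adj Q)\<^sup>*" "u \<in> verts Q" for u v
      using that
    proof (induction rule: rtrancl_induct)
      case base then show ?case using r(1) by (auto simp: refl_on_def)
    next
      case (step y z) then show ?case using a r(2) by (meson subsetD transD)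
    qed
    then show "edge_order Q \<subseteq> r" unfolding edge_order_def by auto
  qed
  then show ?thesis unfolding linear_extensions_def by auto
qed

lemma finite_linear_extensions: "finite_quiver Q \<Longrightarrow> finite (linear_extensions Q)"
  by (rule finite_subset[of _ "Pow (verts Q \<times> verts Q)"])
    (auto simp: linear_extensions_def order_on_defs finite_quiver_def)

lemma card_linear_extensions_le:
  assumes P: "finite_quiver P" and Q: "finite_quiver Q" and iso: "quiver_iso P Q"
  shows "card (linear_extensions P) \<le> card (linear_extensions Q)"
proof -
  obtain f where f: "bij_betw f (verts P) (verts Q)" and adj: "adj Q = map_prod f f ` adj P"
    using iso by (auto elim: quiver_isoE)
  let ?F = "image (map_prod f f)"
  have "linear_extensions P \<subseteq> Pow (verts P \<times> verts P)"
    unfolding linear_extensions_def order_on_defs by auto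
  moreover have "inj_on ?F (Pow (verts P \<times> verts P))"
    using f by (intro inj_on_image_Pow map_prod_inj_on) (auto simp: bij_betw_def)
  ultimately have inj: "inj_on ?F (linear_extensions P)" by (rule inj_on_subset[rotated])
  have "?F r \<in> linear_extensions Q" if "r \<in> linear_extensions P" for r
    using that f adj linear_order_on_image[of f "verts P" r] image_mono[of "adj P" r "map_prod f f"]
    unfolding linear_extensions_eq[OF P] linear_extensions_eq[OF Q] bij_betw_def by simp
  then have "?F ` linear_extensions P \<subseteq> linear_extensions Q" by blast
  with inj show ?thesis using finite_linear_extensions[OF Q] by (rule card_inj_on_le)
qed

lemma e0_quiver_iso:
  fixes P :: "('v, 'e, 'k::field_char_0) quiver" and Q :: "('w, 'f, 'k) quiver"
  assumes P: "finite_quiver P" and Q: "finite_quiver Q" and iso: "quiver_iso P Q"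
  shows "e0_quiver P = e0_quiver Q"
proof -
  have "card (linear_extensions P) = card (linear_extensions Q)"
    using card_linear_extensions_le[OF P Q iso] card_linear_extensions_le[OF Q P quiver_iso_sym[OF P iso]]
    by simp
  moreover obtain f where f: "bij_betw f (verts P) (verts Q)" and adj: "adj Q = map_prod f f ` adj P"
    using iso by (auto elim: quiver_isoE)
  moreover have "acyclic (adj Q) \<longleftrightarrow> acyclic (adj P)"
    unfolding adj by (rule acyclic_map_prod_iff[OF _ adj_subset[OF P]]) (use f in \<open>simp add: bij_betw_def\<close>)
  moreover have "card (verts P) = card (verts Q)" using f by (rule bij_betw_same_card)
  ultimately show ?thesis unfolding e0_quiver_def by simp
qed

lemma e_quiver_iso:
  fixes P :: "('v, 'e, 'k::field_char_0) quiver" and Q :: "('w, 'f, 'k) quiver"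
  assumes P: "finite_quiver P" and Q: "finite_quiver Q" and iso: "quiver_iso P Q"
  shows "e_quiver P = e_quiver Q"
proof -
  obtain f g where f: "bij_betw f (verts P) (verts Q)" and g: "bij_betw g (edges P) (edges Q)"
    and h: "\<And>x. x \<in> edges P \<Longrightarrow> ends Q (g x) = map_prod f f (ends P x)"
      "\<And>x. x \<in> edges P \<Longrightarrow> decor Q (g x) = decor P x"
    using iso by (auto elim: quiver_isoE)
  have tad: "g x \<in> tadpoles Q \<longleftrightarrow> x \<in> tadpoles P" if x: "x \<in> edges P" for x
  proof -
    have "ends P x \<in> verts P \<times> verts P" using x P by (auto simp: finite_quiver_def)
    moreover have "g x \<in> edges Q" using x g by (auto simp: bij_betw_def)
    ultimately show ?thesis
      using x h(1)[OF x] f unfolding tadpoles_def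
      by (cases "ends P x") (auto simp: bij_betw_def inj_on_eq_iff)
  qed
  have sub: "tadpoles P \<subseteq> edges P" "tadpoles Q \<subseteq> edges Q" by (auto simp: tadpoles_def)
  have inj: "inj_on g (edges P)" and im: "g ` edges P = edges Q"
    using g by (simp_all add: bij_betw_def)
  have imt: "g ` tadpoles P = tadpoles Q"
  proof (intro subset_antisym subsetI)
    fix y assume "y \<in> g ` tadpoles P"
    then show "y \<in> tadpoles Q" using subsetD[OF sub(1)] tad by (elim imageE) simp
  next
    fix y assume y: "y \<in> tadpoles Q"
    with sub(2) im have "y \<in> g ` edges P" by auto
    then show "y \<in> g ` tadpoles P" using tad y by (elim imageE) simp
  qed
  then have "bij_betw g (tadpoles P) (tadpoles Q)"
    using inj_on_subset[OF inj sub(1)] by (simp add: bij_betw_def)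
  then have "(\<Prod>x\<in>tadpoles P. - beta_minus (decor Q (g x))) = (\<Prod>x\<in>tadpoles Q. - beta_minus (decor Q x))"
    by (rule prod.reindex_bij_betw)
  moreover have "(\<Prod>x\<in>tadpoles P. - beta_minus (decor P x)) = (\<Prod>x\<in>tadpoles P. - beta_minus (decor Q (g x)))"
    by (rule prod.cong) (use h(2) sub(1) in auto)
  moreover have "g ` (edges P - tadpoles P) = edges Q - tadpoles Q"
    using inj_on_image_set_diff[OF inj, of "edges P" "tadpoles P"] sub(1) im imt by simp
  then have "bij_betw g (edges P - tadpoles P) (edges Q - tadpoles Q)"
    using inj_on_subset[OF inj, of "edges P - tadpoles P"] by (auto simp: bij_betw_def)
  then have "quiver_iso (pruned P) (pruned Q)"
    by (intro quiver_isoI[of f _ _ g]) (use f h in \<open>auto simp: pruned_def\<close>)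
  then have "e0_quiver (pruned P) = e0_quiver (pruned Q)"
    by (intro e0_quiver_iso finite_quiver_pruned P Q)
  ultimately show ?thesis unfolding e_quiver_def by simp
qed

section \<open>Isomorphism classes\<close>

text \<open>Every finite quiver, over whatever types of vertices and edges, is isomorphic to one with
  natural numbers as vertices and edges, so these suffice to represent all isomorphism classes.\<close>

quotient_type 'k qclass = "(nat, nat, 'k) quiver" / partial:
  "\<lambda>P Q. finite_quiver P \<and> finite_quiver Q \<and> quiver_iso P Q"
proof (rule part_equivpI)
  show "\<exists>P :: (nat, nat, 'k) quiver. finite_quiver P \<and> finite_quiver P \<and> quiver_iso P P"
    by (rule exI[of _ empty_quiver])
      (use quiver_iso_refl in \<open>auto simp: finite_quiver_def empty_quiver_def\<close>)
  show "symp (\<lambda>P Q :: (nat, nat, 'k) quiver. finite_quiver P \<and> finite_quiver Q \<and> quiver_iso P Q)"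
    by (auto intro!: sympI quiver_iso_sym)
  show "transp (\<lambda>P Q :: (nat, nat, 'k) quiver. finite_quiver P \<and> finite_quiver Q \<and> quiver_iso P Q)"
    by (auto intro!: transpI intro: quiver_iso_trans)
qed

definition iso_class :: "('v, 'e, 'k) quiver \<Rightarrow> 'k qclass" where
  "iso_class Q = abs_qclass (SOME P. finite_quiver P \<and> quiver_iso P Q)"

lemma ex_nat_quiver:
  assumes "finite_quiver Q"
  shows "\<exists>P :: (nat, nat, 'k) quiver. finite_quiver P \<and> quiver_iso P (Q :: ('v, 'e, 'k) quiver)"
proof -
  obtain f :: "'v \<Rightarrow> nat" and g :: "'e \<Rightarrow> nat" where f: "inj_on f (verts Q)" and g: "inj_on g (edges Q)"
    using assms unfolding finite_quiver_def by (meson finite_imp_inj_to_nat_seg)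
  let ?g = "inv_into (edges Q) g"
  define P where "P = \<lparr>verts = f ` verts Q, edges = g ` edges Q,
    ends = (\<lambda>x. map_prod f f (ends Q (?g x))), decor = decor Q \<circ> ?g\<rparr>"
  have "quiver_iso Q P"
    by (rule quiver_isoI[of f _ _ g]) (use f g in \<open>auto simp: P_def bij_betw_def\<close>)
  moreover have "finite_quiver P"
    using assms g unfolding finite_quiver_def P_def by fastforce
  ultimately show ?thesis using quiver_iso_sym[OF assms] by blast
qed

lemma iso_class_eq_iff:
  fixes P :: "('v, 'e, 'k) quiver" and Q :: "('w, 'f, 'k) quiver"
  assumes "finite_quiver P" "finite_quiver Q"
  shows "iso_class P = iso_class Q \<longleftrightarrow> quiver_iso P Q"
proof -
  define P' :: "(nat, nat, 'k) quiver" where "P' = (SOME P'. finite_quiver P' \<and> quiver_iso P' P)"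
  define Q' :: "(nat, nat, 'k) quiver" where "Q' = (SOME Q'. finite_quiver Q' \<and> quiver_iso Q' Q)"
  have P': "finite_quiver P'" "quiver_iso P' P"
    using someI_ex[OF ex_nat_quiver[OF assms(1)]] unfolding P'_def by auto
  have Q': "finite_quiver Q'" "quiver_iso Q' Q"
    using someI_ex[OF ex_nat_quiver[OF assms(2)]] unfolding Q'_def by auto
  have "iso_class P = iso_class Q \<longleftrightarrow> quiver_iso P' Q'"
    unfolding iso_class_def P'_def[symmetric] Q'_def[symmetric]
    using Quotient3_rel[OF Quotient3_qclass, of P' Q'] P' Q' quiver_iso_refl[of P'] quiver_iso_refl[of Q'] by auto
  then show ?thesis
    using P' Q' assms by (meson quiver_iso_sym quiver_iso_trans)
qed

lemma finite_rep_qclass: "finite_quiver (rep_qclass c)"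
  using Quotient3_rep_reflp[OF Quotient3_qclass, of c] by blast

lemma iso_class_rep: "iso_class (rep_qclass c) = c"
proof -
  let ?P = "SOME P :: (nat, nat, 'a) quiver. finite_quiver P \<and> quiver_iso P (rep_qclass c)"
  have "finite_quiver ?P \<and> quiver_iso ?P (rep_qclass c)"
    by (rule someI_ex[OF ex_nat_quiver[OF finite_rep_qclass]])
  then show ?thesis
    unfolding iso_class_def
    using Quotient3_rel_abs[OF Quotient3_qclass, of ?P "rep_qclass c"]
      Quotient3_abs_rep[OF Quotient3_qclass, of c] finite_rep_qclass[of c] by simp
qed

lemma rep_iso_class: "finite_quiver Q \<Longrightarrow> quiver_iso (rep_qclass (iso_class Q)) Q"
  using iso_class_eq_iff[OF finite_rep_qclass] iso_class_rep by blast

lemma iso_class_eqI: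
  assumes "finite_quiver P" "quiver_iso P Q" "finite_quiver Q" shows "iso_class P = iso_class Q"
  using assms iso_class_eq_iff by blast

lemma verts_disj_union [simp]: "verts (disj_union P Q) = verts P <+> verts Q"
  and edges_disj_union [simp]: "edges (disj_union P Q) = edges P <+> edges Q"
  and ends_disj_union [simp]: "ends (disj_union P Q) (Inl x) = map_prod Inl Inl (ends P x)"
    "ends (disj_union P Q) (Inr y) = map_prod Inr Inr (ends Q y)"
  and decor_disj_union [simp]: "decor (disj_union P Q) (Inl x) = decor P x"
    "decor (disj_union P Q) (Inr y) = decor Q y"
  by (simp_all add: disj_union_def)

lemma bij_betw_map_sum:
  "bij_betw f A B \<Longrightarrow> bij_betw g C D \<Longrightarrow> bij_betw (map_sum f g) (A <+> C) (B <+> D)"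
  unfolding bij_betw_def
proof (elim conjE, intro conjI)
  assume "inj_on f A" "inj_on g C"
  then show "inj_on (map_sum f g) (A <+> C)"
    by (intro inj_onI) (auto dest: inj_onD)
  assume B: "f ` A = B" and D: "g ` C = D"
  show "map_sum f g ` (A <+> C) = B <+> D"
    unfolding B[symmetric] D[symmetric] Plus_def image_Un image_image by simp
qed

lemma disj_union_iso:
  assumes "quiver_iso P P'" "quiver_iso Q Q'"
  shows "quiver_iso (disj_union P Q) (disj_union P' Q')"
proof -
  obtain f g where P: "bij_betw f (verts P) (verts P')" "bij_betw g (edges P) (edges P')"
    "\<And>x. x \<in> edges P \<Longrightarrow> ends P' (g x) = map_prod f f (ends P x)"
    "\<And>x. x \<in> edges P \<Longrightarrow> decor P' (g x) = decor P x"
    using assms(1) by (auto elim: quiver_isoE)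
  obtain f' g' where Q: "bij_betw f' (verts Q) (verts Q')" "bij_betw g' (edges Q) (edges Q')"
    "\<And>x. x \<in> edges Q \<Longrightarrow> ends Q' (g' x) = map_prod f' f' (ends Q x)"
    "\<And>x. x \<in> edges Q \<Longrightarrow> decor Q' (g' x) = decor Q x"
    using assms(2) by (auto elim: quiver_isoE)
  show ?thesis
    by (rule quiver_isoI[of "map_sum f f'" _ _ "map_sum g g'"])
      (use P(1,2) Q(1,2) in \<open>auto simp: bij_betw_map_sum P(3,4) Q(3,4) prod.map_comp o_def\<close>)
qed

instantiation qclass :: (type) comm_monoid_add
begin

definition zero_qclass :: "'a qclass" where
  "zero_qclass = iso_class (empty_quiver :: (nat, nat, 'a) quiver)"

definition plus_qclass :: "'a qclass \<Rightarrow> 'a qclass \<Rightarrow> 'a qclass" where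
  "plus_qclass c d = iso_class (disj_union (rep_qclass c) (rep_qclass d))"

lemma iso_class_disj_union:
  fixes P :: "('v, 'e, 'a) quiver" and Q :: "('w, 'f, 'a) quiver"
  assumes "finite_quiver P" "finite_quiver Q"
  shows "iso_class (disj_union P Q) = iso_class P + iso_class Q"
  unfolding plus_qclass_def
  using assms by (intro iso_class_eqI finite_quiver_disj_union disj_union_iso finite_rep_qclass
      quiver_iso_sym[OF finite_rep_qclass] rep_iso_class)

instance
proof
  fix a b c :: "'a qclass"
  let ?a = "rep_qclass a" and ?b = "rep_qclass b" and ?c = "rep_qclass c"
  note fin = finite_rep_qclass[of a] finite_rep_qclass[of b] finite_rep_qclass[of c]
  have "bij_betw (case_sum (map_sum id Inl) (Inr \<circ> Inr)) ((A <+> B) <+> C) (A <+> (B <+> C))"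
    for A B C :: "nat set"
    by (rule bij_betw_byWitness[of _ "case_sum (Inl \<circ> Inl) (map_sum Inr id)"]) auto
  then have "quiver_iso (disj_union (disj_union ?a ?b) ?c) (disj_union ?a (disj_union ?b ?c))"
    by (intro quiver_isoI[of "case_sum (map_sum id Inl) (Inr \<circ> Inr)" _ _ "case_sum (map_sum id Inl) (Inr \<circ> Inr)"])
      (auto simp: prod.map_comp o_def)
  then have "iso_class (disj_union (disj_union ?a ?b) ?c) = iso_class (disj_union ?a (disj_union ?b ?c))"
    by (intro iso_class_eqI finite_quiver_disj_union fin)
  then show "a + b + c = a + (b + c)"
    by (simp add: iso_class_disj_union finite_quiver_disj_union fin iso_class_rep)
  have "bij_betw (case_sum Inr Inl) (A <+> B) (B <+> A)" for A B :: "nat set"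
    by (rule bij_betw_byWitness[of _ "case_sum Inr Inl"]) auto
  then have "quiver_iso (disj_union ?a ?b) (disj_union ?b ?a)"
    by (intro quiver_isoI[of "case_sum Inr Inl" _ _ "case_sum Inr Inl"])
      (auto simp: prod.map_comp o_def)
  then have "iso_class (disj_union ?a ?b) = iso_class (disj_union ?b ?a)"
    by (intro iso_class_eqI finite_quiver_disj_union fin)
  then show "a + b = b + a"
    by (simp add: iso_class_disj_union fin iso_class_rep)
  let ?e = "empty_quiver :: (nat, nat, 'a) quiver"
  have e: "finite_quiver ?e" by (simp add: finite_quiver_def empty_quiver_def)
  have "quiver_iso ?a (disj_union ?e ?a)"
    by (rule quiver_isoI[of Inr _ _ Inr]) (auto simp: empty_quiver_def bij_betw_def)
  then have "iso_class ?a = iso_class (disj_union ?e ?a)"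
    by (intro iso_class_eqI finite_quiver_disj_union fin e)
  then show "0 + a = a"
    by (simp add: iso_class_disj_union fin e iso_class_rep flip: zero_qclass_def)
qed

end

section \<open>Disjoint unions, cuts and contractions\<close>

lemma rtrancl_Plus:
  fixes r :: "('a \<times> 'a) set" and s :: "('b \<times> 'b) set"
  defines "R \<equiv> map_prod Inl Inl ` r \<union> map_prod Inr Inr ` s"
  shows "(Inl u, b) \<in> R\<^sup>* \<longleftrightarrow> (\<exists>v. b = Inl v \<and> (u, v) \<in> r\<^sup>*)"
    and "(Inr w, b) \<in> R\<^sup>* \<longleftrightarrow> (\<exists>v. b = Inr v \<and> (w, v) \<in> s\<^sup>*)"
proof -
  have "\<exists>v. b = Inl v \<and> (u, v) \<in> r\<^sup>*" if "(Inl u, b) \<in> R\<^sup>*"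
    using that
  proof (induction rule: rtrancl_induct)
    case (step y z)
    then show ?case unfolding R_def by (auto intro: rtrancl.rtrancl_into_rtrancl)
  qed simp
  moreover have "(Inl u, Inl v) \<in> R\<^sup>*" if "(u, v) \<in> r\<^sup>*" for v
    using rtrancl_map_prod[OF that, of Inl] rtrancl_mono[of "map_prod Inl Inl ` r" R] unfolding R_def by auto
  ultimately show "(Inl u, b) \<in> R\<^sup>* \<longleftrightarrow> (\<exists>v. b = Inl v \<and> (u, v) \<in> r\<^sup>*)" by blast
  have "\<exists>v. b = Inr v \<and> (w, v) \<in> s\<^sup>*" if "(Inr w, b) \<in> R\<^sup>*"
    using that
  proof (induction rule: rtrancl_induct)
    case (step y z)
    then show ?case unfolding R_def by (auto intro: rtrancl.rtrancl_into_rtrancl)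
  qed simp
  moreover have "(Inr w, Inr v) \<in> R\<^sup>*" if "(w, v) \<in> s\<^sup>*" for v
    using rtrancl_map_prod[OF that, of Inr] rtrancl_mono[of "map_prod Inr Inr ` s" R] unfolding R_def by auto
  ultimately show "(Inr w, b) \<in> R\<^sup>* \<longleftrightarrow> (\<exists>v. b = Inr v \<and> (w, v) \<in> s\<^sup>*)" by blast
qed

lemma converse_map_prod: "(map_prod f f ` r)\<inverse> = map_prod f f ` r\<inverse>"
  by (intro subset_antisym subrelI) (auto intro: map_prod_imageI)

lemma adj_disj_union: "adj (disj_union P Q) = map_prod Inl Inl ` adj P \<union> map_prod Inr Inr ` adj Q"
  unfolding adj_def edges_disj_union Plus_def image_Un image_image by simp

lemma connectivity_disj_union:
  shows "v \<in> verts P \<Longrightarrow> connectivity (disj_union P Q) `` {Inl v} = Inl ` (connectivity P `` {v})"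
    and "w \<in> verts Q \<Longrightarrow> connectivity (disj_union P Q) `` {Inr w} = Inr ` (connectivity Q `` {w})"
proof -
  let ?p = "adj P \<union> (adj P)\<inverse>" and ?q = "adj Q \<union> (adj Q)\<inverse>"
  have R: "adj (disj_union P Q) \<union> (adj (disj_union P Q))\<inverse> = map_prod Inl Inl ` ?p \<union> map_prod Inr Inr ` ?q"
    unfolding adj_disj_union converse_Un image_Un converse_map_prod by (simp add: ac_simps)
  show "v \<in> verts P \<Longrightarrow> connectivity (disj_union P Q) `` {Inl v} = Inl ` (connectivity P `` {v})"
    and "w \<in> verts Q \<Longrightarrow> connectivity (disj_union P Q) `` {Inr w} = Inr ` (connectivity Q `` {w})"
    unfolding connectivity_def R by (auto simp: rtrancl_Plus)
qed

lemma cut_disj_union: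
  "quiver_iso (disj_union (cut_subquiver P F) (cut_subquiver Q G)) (cut_subquiver (disj_union P Q) (F <+> G))"
  by (rule quiver_isoI[of id _ _ id]) (auto simp: cut_subquiver_def prod.map_id0)

lemma contract_disj_union:
  fixes P :: "('v, 'e, 'k) quiver" and Q :: "('w, 'f, 'k) quiver"
  assumes "finite_quiver P" "finite_quiver Q"
  shows "quiver_iso (disj_union (contract P F) (contract Q G)) (contract (disj_union P Q) (F <+> G))"
proof -
  let ?P = "cut_subquiver P F" and ?Q = "cut_subquiver Q G" and ?R = "cut_subquiver (disj_union P Q) (F <+> G)"
  let ?f = "case_sum (image Inl) (image Inr) :: 'v set + 'w set \<Rightarrow> ('v + 'w) set"
  have eq: "connectivity ?R = connectivity (disj_union ?P ?Q)"
    unfolding connectivity_def adj_def by (simp add: cut_subquiver_def disj_union_def)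
  have conn: "connectivity ?R `` {Inl v} = Inl ` (connectivity ?P `` {v})" if "v \<in> verts P" for v
    unfolding eq using that by (intro connectivity_disj_union) (simp add: cut_subquiver_def)
  have conn': "connectivity ?R `` {Inr v} = Inr ` (connectivity ?Q `` {v})" if "v \<in> verts Q" for v
    unfolding eq using that by (intro connectivity_disj_union) (simp add: cut_subquiver_def)
  have im: "?f ` (components ?P <+> components ?Q) = components ?R"
  proof -
    have v: "verts ?P = verts P" "verts ?Q = verts Q" "verts ?R = Inl ` verts P \<union> Inr ` verts Q"
      by (auto simp: cut_subquiver_def)
    have "?f ` (components ?P <+> components ?Q) =
        (\<lambda>v. Inl ` (connectivity ?P `` {v})) ` verts P \<union> (\<lambda>v. Inr ` (connectivity ?Q `` {v})) ` verts Q"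
      unfolding components_eq v Plus_def[of "_ ` _"] image_Un image_image by simp
    also have "\<dots> = (\<lambda>v. connectivity ?R `` {Inl v}) ` verts P \<union> (\<lambda>v. connectivity ?R `` {Inr v}) ` verts Q"
      by (intro arg_cong2[of _ _ _ _ "(\<union>)"] image_cong refl) (simp_all only: conn conn')
    finally show ?thesis
      unfolding components_eq v image_Un image_image .
  qed
  have ne: "C \<noteq> {}" if "C \<in> components S" for C and S :: "('x, 'y, 'z) quiver"
    using that unfolding components_eq connectivity_def by auto
  have inj: "inj_on ?f (components ?P <+> components ?Q)"
  proof (rule inj_onI)
    fix x y assume xy: "x \<in> components ?P <+> components ?Q" "y \<in> components ?P <+> components ?Q"
      and "?f x = ?f y"
    moreover have "Inl ` A \<noteq> Inr ` B" if "A \<noteq> {}" for A :: "'v set" and B :: "'w set"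
      using that by auto
    ultimately show "x = y"
      by (cases x; cases y) (auto simp: inj_image_eq_iff components_eq connectivity_def cut_subquiver_def; metis)+
  qed
  show ?thesis
  proof (rule quiver_isoI[of ?f _ _ id])
    show "bij_betw ?f (verts (disj_union (contract P F) (contract Q G))) (verts (contract (disj_union P Q) (F <+> G)))"
      using inj im by (simp add: bij_betw_def contract_def Let_def)
    have "(edges P - F) <+> (edges Q - G) = (edges P <+> edges Q) - (F <+> G)" by auto
    then show "bij_betw id (edges (disj_union (contract P F) (contract Q G))) (edges (contract (disj_union P Q) (F <+> G)))"
      by (simp add: contract_def Let_def)
  next
    fix x assume "x \<in> edges (disj_union (contract P F) (contract Q G))"
    then consider a where "x = Inl a" "a \<in> edges P" | b where "x = Inr b" "b \<in> edges Q"
      by (auto simp: contract_def Let_def)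
    then show "ends (contract (disj_union P Q) (F <+> G)) (id x) = map_prod ?f ?f (ends (disj_union (contract P F) (contract Q G)) x)"
    proof cases
      case 1
      then have "ends P a \<in> verts P \<times> verts P" using assms by (auto simp: finite_quiver_def)
      with 1 show ?thesis by (cases "ends P a") (simp add: contract_def Let_def conn)
    next
      case 2
      then have "ends Q b \<in> verts Q \<times> verts Q" using assms by (auto simp: finite_quiver_def)
      with 2 show ?thesis by (cases "ends Q b") (simp add: contract_def Let_def conn')
    qed
    show "decor (contract (disj_union P Q) (F <+> G)) (id x) = decor (disj_union (contract P F) (contract Q G)) x"
      by (cases x) (simp_all add: contract_def Let_def)
  qed
qed

text \<open>The sum of \<open>\<phi> [H] [Q/H]\<close> over all cut-subquivers \<open>H\<close> of \<open>Q\<close>.\<close>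

definition sum_cuts :: "('v, 'e, 'k) quiver \<Rightarrow> ('k qclass \<Rightarrow> 'k qclass \<Rightarrow> 'a::comm_monoid_add) \<Rightarrow> 'a" where
  "sum_cuts Q \<phi> = (\<Sum>F\<in>Pow (edges Q). \<phi> (iso_class (cut_subquiver Q F)) (iso_class (contract Q F)))"

lemma sum_cuts_iso:
  fixes P :: "('v, 'e, 'k) quiver" and Q :: "('w, 'f, 'k) quiver"
  assumes P: "finite_quiver P" and Q: "finite_quiver Q" and iso: "quiver_iso P Q"
  shows "sum_cuts P \<phi> = sum_cuts Q \<phi>"
proof -
  obtain f g where f: "bij_betw f (verts P) (verts Q)" and g: "bij_betw g (edges P) (edges Q)"
    and h: "\<And>x. x \<in> edges P \<Longrightarrow> ends Q (g x) = map_prod f f (ends P x)"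
      "\<And>x. x \<in> edges P \<Longrightarrow> decor Q (g x) = decor P x"
    using iso by (auto elim: quiver_isoE)
  have "iso_class (cut_subquiver P F) = iso_class (cut_subquiver Q (g ` F))"
    "iso_class (contract P F) = iso_class (contract Q (g ` F))" if "F \<subseteq> edges P" for F
    using contract_iso[OF P that f g h] g that
    by (auto intro!: iso_class_eqI finite_quiver_cut finite_quiver_contract P Q simp: bij_betw_def)
  then have "sum_cuts P \<phi> = (\<Sum>F\<in>Pow (edges P). \<phi> (iso_class (cut_subquiver Q (g ` F))) (iso_class (contract Q (g ` F))))"
    unfolding sum_cuts_def by (intro sum.cong) auto
  also have "\<dots> = sum_cuts Q \<phi>"
    unfolding sum_cuts_def by (rule sum.reindex_bij_betw[OF bij_betw_Pow[OF g]])
  finally show ?thesis .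
qed

lemma sum_cuts_disj_union:
  fixes P :: "('v, 'e, 'k) quiver" and Q :: "('w, 'f, 'k) quiver"
  assumes P: "finite_quiver P" and Q: "finite_quiver Q"
  shows "sum_cuts (disj_union P Q) \<phi> =
    sum_cuts P (\<lambda>h k. sum_cuts Q (\<lambda>h' k'. \<phi> (h + h') (k + k')))"
proof -
  let ?\<psi> = "\<lambda>R F. \<phi> (iso_class (cut_subquiver R F)) (iso_class (contract R F))"
  have bij: "bij_betw (\<lambda>(F, G). F <+> G) (Pow (edges P) \<times> Pow (edges Q)) (Pow (edges (disj_union P Q)))"
  proof (rule bij_betw_byWitness[of _ "\<lambda>H. (Inl -` H, Inr -` H)"])
    have "Inl -` H <+> Inr -` H = H" for H :: "('e + 'f) set"
    proof (rule set_eqI)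
      show "x \<in> Inl -` H <+> Inr -` H \<longleftrightarrow> x \<in> H" for x by (cases x) auto
    qed
    then show "\<forall>H\<in>Pow (edges (disj_union P Q)). (case (Inl -` H, Inr -` H) of (F, G) \<Rightarrow> F <+> G) = H"
      by simp
  qed auto
  have "sum_cuts (disj_union P Q) \<phi> =
      (\<Sum>(F, G)\<in>Pow (edges P) \<times> Pow (edges Q). ?\<psi> (disj_union P Q) (F <+> G))"
    unfolding sum_cuts_def by (subst sum.reindex_bij_betw[OF bij, symmetric]) (simp add: case_prod_beta)
  also have "\<dots> = (\<Sum>(F, G)\<in>Pow (edges P) \<times> Pow (edges Q).
      \<phi> (iso_class (cut_subquiver P F) + iso_class (cut_subquiver Q G))
        (iso_class (contract P F) + iso_class (contract Q G)))"
  proof (rule sum.cong[OF refl], clarify)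
    fix F G assume FG: "F \<subseteq> edges P" "G \<subseteq> edges Q"
    note fin = finite_quiver_cut[OF P FG(1)] finite_quiver_cut[OF Q FG(2)]
      finite_quiver_contract[OF P, of F] finite_quiver_contract[OF Q, of G]
    have sub: "F <+> G \<subseteq> edges (disj_union P Q)" using FG by auto
    have "iso_class (cut_subquiver (disj_union P Q) (F <+> G)) = iso_class (disj_union (cut_subquiver P F) (cut_subquiver Q G))"
      by (rule iso_class_eqI[symmetric])
        (intro finite_quiver_disj_union fin cut_disj_union finite_quiver_cut P Q sub)+
    moreover have "iso_class (contract (disj_union P Q) (F <+> G)) = iso_class (disj_union (contract P F) (contract Q G))"
      by (rule iso_class_eqI[symmetric])
        (intro finite_quiver_disj_union fin contract_disj_union finite_quiver_contract P Q)+
    ultimately show "?\<psi> (disj_union P Q) (F <+> G) =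
      \<phi> (iso_class (cut_subquiver P F) + iso_class (cut_subquiver Q G))
        (iso_class (contract P F) + iso_class (contract Q G))"
      by (simp add: iso_class_disj_union fin)
  qed
  also have "\<dots> = sum_cuts P (\<lambda>h k. sum_cuts Q (\<lambda>h' k'. \<phi> (h + h') (k + k')))"
    unfolding sum_cuts_def by (rule sum.cartesian_product[symmetric])
  finally show ?thesis .
qed

section \<open>Linear extensions of disjoint unions\<close>

primrec list_rel :: "'a list \<Rightarrow> ('a \<times> 'a) set" where
  "list_rel [] = {}"
| "list_rel (x # xs) = {x} \<times> set (x # xs) \<union> list_rel xs"

lemma list_rel_subset: "list_rel xs \<subseteq> set xs \<times> set xs"
  by (induction xs) auto

lemma linear_order_list_rel: "distinct xs \<Longrightarrow> linear_order_on (set xs) (list_rel xs)"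
proof (induction xs)
  case (Cons x xs)
  then have IH: "refl_on (set xs) (list_rel xs)" "trans (list_rel xs)" "antisym (list_rel xs)" "total_on (set xs) (list_rel xs)"
    and x: "x \<notin> set xs"
    by (auto simp: order_on_defs)
  note sub = list_rel_subset[of xs]
  have "trans (list_rel (x # xs))"
    using IH(2) x sub by (intro transI) (auto dest: transD)
  moreover have "antisym (list_rel (x # xs))"
    using IH(3) x sub by (intro antisymI) (auto dest: antisymD)
  moreover have "refl_on (set (x # xs)) (list_rel (x # xs))" "total_on (set (x # xs)) (list_rel (x # xs))"
    using IH by (auto simp: refl_on_def total_on_def)
  ultimately show ?case using list_rel_subset[of "x # xs"] by (simp add: order_on_defs)
qed simp

lemma list_rel_restrict: "x \<notin> set xs \<Longrightarrow> list_rel xs = list_rel (x # xs) \<inter> set xs \<times> set xs"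
  using list_rel_subset[of xs] by auto

lemma list_rel_inj:
  "distinct xs \<Longrightarrow> distinct ys \<Longrightarrow> set xs = set ys \<Longrightarrow> list_rel xs = list_rel ys \<Longrightarrow> xs = ys"
proof (induction xs arbitrary: ys)
  case (Cons x xs)
  then obtain y zs where ys: "ys = y # zs" by (cases ys) auto
  have "(x, y) \<in> list_rel ys" "(y, x) \<in> list_rel ys"
    using Cons.prems(3,4) unfolding ys by auto
  then have xy: "x = y"
    using linear_order_list_rel[OF Cons.prems(2)] by (auto simp: order_on_defs dest: antisymD)
  have set: "set xs = set zs" using Cons.prems unfolding ys xy by auto
  have "list_rel xs = list_rel (x # xs) \<inter> set xs \<times> set xs"
    using Cons.prems(1) by (intro list_rel_restrict) simp
  also have "\<dots> = list_rel (y # zs) \<inter> set zs \<times> set zs"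
    by (simp only: Cons.prems(4) ys set)
  also have "\<dots> = list_rel zs"
    using Cons.prems(2) unfolding ys by (intro list_rel_restrict[symmetric]) simp
  finally have "list_rel xs = list_rel zs" .
  then show ?case using Cons.IH[of zs] Cons.prems set ys xy by auto
qed simp

lemma list_rel_surj:
  "finite V \<Longrightarrow> linear_order_on V r \<Longrightarrow> \<exists>xs. distinct xs \<and> set xs = V \<and> list_rel xs = r"
proof (induction "card V" arbitrary: V r)
  case 0
  then show ?case by (intro exI[of _ "[]"]) (auto simp: order_on_defs)
next
  case (Suc n)
  have r: "refl_on V r" "trans r" "antisym r" "total_on V r" "r \<subseteq> V \<times> V"
    using Suc.prems by (auto simp: order_on_defs)
  have "\<exists>m\<in>A. \<forall>y\<in>A. (m, y) \<in> r" if "finite A" "A \<noteq> {}" "A \<subseteq> V" for A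
    using that
  proof (induction rule: finite_ne_induct)
    case (singleton x)
    then show ?case using r(1) by (auto simp: refl_on_def)
  next
    case (insert x A)
    then obtain m where m: "m \<in> A" "\<forall>y\<in>A. (m, y) \<in> r" by auto
    have xm: "x \<in> V" "m \<in> V" using insert.prems m by auto
    then have xx: "(x, x) \<in> r" using r(1) by (auto simp: refl_on_def)
    show ?case
    proof (cases "(m, x) \<in> r")
      case True with m show ?thesis by auto
    next
      case False
      then have "(x, m) \<in> r" using xm xx r(4) by (auto simp: total_on_def)
      then have "\<forall>y\<in>insert x A. (x, y) \<in> r" using m(2) xx r(2) by (auto dest: transD)
      then show ?thesis by auto
    qed
  qed
  from this[of V] Suc.hyps Suc.prems obtain m where m: "m \<in> V" "\<forall>y\<in>V. (m, y) \<in> r" by fastforce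
  let ?V = "V - {m}"
  let ?r = "r \<inter> ?V \<times> ?V"
  have "trans ?r" using r(2) unfolding trans_def by blast
  moreover have "antisym ?r" using r(3) unfolding antisym_def by blast
  moreover have "refl_on ?V ?r" using r(1) unfolding refl_on_def by blast
  moreover have "total_on ?V ?r" using r(4) unfolding total_on_def by blast
  ultimately have "linear_order_on ?V ?r" by (auto simp: order_on_defs)
  moreover have "n = card ?V" using Suc.hyps(2) Suc.prems(1) m(1) by simp
  ultimately obtain xs where xs: "distinct xs" "set xs = ?V" "list_rel xs = ?r"
    using Suc.hyps(1)[of ?V ?r] Suc.prems(1) by auto
  have "r = {m} \<times> V \<union> ?r"
  proof (intro subset_antisym subrelI)
    fix a b assume ab: "(a, b) \<in> r"
    then have "a \<in> V" "b \<in> V" using r(5) by auto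
    moreover have "a = m" if "b = m"
      using ab m(2) \<open>a \<in> V\<close> r(3) that by (auto dest: antisymD)
    ultimately show "(a, b) \<in> {m} \<times> V \<union> ?r" using ab by auto
  qed (use m in auto)
  then have "distinct (m # xs) \<and> set (m # xs) = V \<and> list_rel (m # xs) = r"
    using xs m(1) by auto
  then show ?case by blast
qed

lemma list_rel_filter: "list_rel (filter P xs) = list_rel xs \<inter> {x. P x} \<times> {x. P x}"
  by (induction xs) auto

lemma list_rel_map: "list_rel (map f xs) = map_prod f f ` list_rel xs"
  by (induction xs) (auto simp: image_Un image_iff)

definition extension_lists :: "('v, 'e, 'k) quiver \<Rightarrow> 'v list set" where
  "extension_lists Q = {xs. distinct xs \<and> set xs = verts Q \<and> adj Q \<subseteq> list_rel xs}"

lemma card_extension_lists: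
  assumes "finite_quiver Q"
  shows "card (linear_extensions Q) = card (extension_lists Q)"
proof -
  have fin: "finite (verts Q)" using assms by (simp add: finite_quiver_def)
  have "bij_betw list_rel (extension_lists Q) (linear_extensions Q)"
    unfolding bij_betw_def linear_extensions_eq[OF assms] extension_lists_def
  proof (intro conjI inj_onI subset_antisym subsetI)
    fix r assume "r \<in> {r. linear_order_on (verts Q) r \<and> adj Q \<subseteq> r}"
    with list_rel_surj[OF fin, of r]
    show "r \<in> list_rel ` {xs. distinct xs \<and> set xs = verts Q \<and> adj Q \<subseteq> list_rel xs}" by auto
  next
    fix r assume "r \<in> list_rel ` {xs. distinct xs \<and> set xs = verts Q \<and> adj Q \<subseteq> list_rel xs}"
    then show "r \<in> {r. linear_order_on (verts Q) r \<and> adj Q \<subseteq> r}"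
      using linear_order_list_rel by fastforce
  qed (auto intro: list_rel_inj)
  then show ?thesis by (simp add: bij_betw_same_card)
qed

lemma finite_extension_lists: "finite_quiver Q \<Longrightarrow> finite (extension_lists Q)"
  by (rule finite_subset[of _ "{xs. set xs \<subseteq> verts Q \<and> length xs = card (verts Q)}"])
    (auto simp: extension_lists_def finite_quiver_def dest: distinct_card intro!: finite_lists_length_eq)

lemma filter_shuffles_sum:
  assumes "zs \<in> shuffles (map Inl xs) (map Inr ys)"
  shows "filter isl zs = map Inl xs" "filter (\<lambda>z. \<not> isl z) zs = map Inr ys"
proof -
  have "set zs = Inl ` set xs \<union> Inr ` set ys" using set_shuffles[OF assms] by simp
  then have "filter isl zs = filter (\<lambda>z. z \<in> set (map Inl xs)) zs"
    "filter (\<lambda>z. \<not> isl z) zs = filter (\<lambda>z. z \<notin> set (map Inl xs)) zs"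
    by (auto intro!: filter_cong)
  moreover have "set (map Inl xs) \<inter> set (map Inr ys) = {}" by auto
  ultimately show "filter isl zs = map Inl xs" "filter (\<lambda>z. \<not> isl z) zs = map Inr ys"
    using filter_shuffles_disjoint1[OF _ assms] by simp_all
qed

lemma extension_lists_disj_union:
  fixes P :: "('v, 'e, 'k) quiver" and Q :: "('w, 'f, 'k) quiver"
  shows "extension_lists (disj_union P Q) =
     (\<Union>(xs, ys)\<in>extension_lists P \<times> extension_lists Q. shuffles (map Inl xs) (map Inr ys))"
proof -
  have adj: "adj (disj_union P Q) \<subseteq> list_rel zs \<longleftrightarrow> adj P \<subseteq> list_rel xs \<and> adj Q \<subseteq> list_rel ys"
    if "filter isl zs = map Inl xs" "filter (\<lambda>z. \<not> isl z) zs = map Inr ys" for zs xs ys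
  proof -
    have "map_prod Inl Inl ` adj P \<subseteq> list_rel zs \<longleftrightarrow> map_prod Inl Inl ` adj P \<subseteq> list_rel (filter isl zs)"
      unfolding list_rel_filter by auto
    also have "\<dots> \<longleftrightarrow> adj P \<subseteq> list_rel xs"
      unfolding that list_rel_map by (rule inj_image_subset_iff) (simp add: prod.inj_map)
    finally have 1: "map_prod Inl Inl ` adj P \<subseteq> list_rel zs \<longleftrightarrow> adj P \<subseteq> list_rel xs" .
    have "map_prod Inr Inr ` adj Q \<subseteq> list_rel zs \<longleftrightarrow> map_prod Inr Inr ` adj Q \<subseteq> list_rel (filter (\<lambda>z. \<not> isl z) zs)"
      unfolding list_rel_filter by auto
    also have "\<dots> \<longleftrightarrow> adj Q \<subseteq> list_rel ys"
      unfolding that list_rel_map by (rule inj_image_subset_iff) (simp add: prod.inj_map)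
    finally show ?thesis using 1 by (simp add: adj_disj_union)
  qed
  show ?thesis
  proof (intro subset_antisym subsetI)
    fix zs assume zs: "zs \<in> extension_lists (disj_union P Q)"
    define xs where "xs = map projl (filter isl zs)"
    define ys where "ys = map projr (filter (\<lambda>z. \<not> isl z) zs)"
    have xs: "filter isl zs = map Inl xs" and ys: "filter (\<lambda>z. \<not> isl z) zs = map Inr ys"
      unfolding xs_def ys_def by (auto intro!: map_idI[symmetric])
    have "distinct (map Inl xs :: ('v + 'w) list)" "distinct (map Inr ys :: ('v + 'w) list)"
      using zs unfolding xs[symmetric] ys[symmetric] extension_lists_def by auto
    then have d: "distinct xs" "distinct ys" by (auto simp: distinct_map)
    have "Inl ` set xs = set (filter isl zs)" "Inr ` set ys = set (filter (\<lambda>z. \<not> isl z) zs)"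
      unfolding xs ys by simp_all
    then have "Inl ` set xs = (Inl ` verts P :: ('v + 'w) set)" "Inr ` set ys = (Inr ` verts Q :: ('v + 'w) set)"
      using zs unfolding extension_lists_def by auto
    then have "set xs = verts P" "set ys = verts Q" by (simp_all add: inj_image_eq_iff)
    then have "xs \<in> extension_lists P" "ys \<in> extension_lists Q"
      using zs d adj[OF xs ys] unfolding extension_lists_def by auto
    moreover have "zs \<in> shuffles (map Inl xs) (map Inr ys)"
      using partition_in_shuffles[of zs isl] unfolding xs ys .
    ultimately show "zs \<in> (\<Union>(xs, ys)\<in>extension_lists P \<times> extension_lists Q. shuffles (map Inl xs) (map Inr ys))"
      by blast
  next
    fix zs assume "zs \<in> (\<Union>(xs, ys)\<in>extension_lists P \<times> extension_lists Q. shuffles (map Inl xs) (map Inr ys))"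
    then obtain xs ys where xs: "xs \<in> extension_lists P" and ys: "ys \<in> extension_lists Q"
      and zs: "zs \<in> shuffles (map Inl xs) (map Inr ys)" by blast
    have "distinct zs"
      by (rule distinct_disjoint_shuffles[OF _ _ _ zs])
        (use xs ys in \<open>auto simp: extension_lists_def distinct_map\<close>)
    moreover have "set zs = verts P <+> verts Q"
      using set_shuffles[OF zs] xs ys by (simp add: extension_lists_def Plus_def)
    moreover have "adj (disj_union P Q) \<subseteq> list_rel zs"
      using adj[OF filter_shuffles_sum[OF zs]] xs ys by (simp add: extension_lists_def)
    ultimately show "zs \<in> extension_lists (disj_union P Q)"
      by (simp add: extension_lists_def)
  qed
qed

lemma card_linear_extensions_disj_union:
  fixes P :: "('v, 'e, 'k) quiver" and Q :: "('w, 'f, 'k) quiver"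
  assumes P: "finite_quiver P" and Q: "finite_quiver Q"
  shows "card (linear_extensions (disj_union P Q)) =
    card (linear_extensions P) * card (linear_extensions Q) * ((card (verts P) + card (verts Q)) choose card (verts P))"
proof -
  let ?A = "extension_lists P \<times> extension_lists Q"
  let ?s = "\<lambda>(xs, ys). shuffles (map Inl xs) (map Inr ys)"
  have "card (extension_lists (disj_union P Q)) = (\<Sum>p\<in>?A. card (?s p))"
    unfolding extension_lists_disj_union
  proof (rule card_UN_disjoint)
    show "finite ?A" using finite_extension_lists[OF P] finite_extension_lists[OF Q] by simp
    show "\<forall>p\<in>?A. finite (?s p)" by auto
    show "\<forall>p\<in>?A. \<forall>q\<in>?A. p \<noteq> q \<longrightarrow> ?s p \<inter> ?s q = {}"
    proof (intro ballI impI)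
      fix p q assume "p \<in> ?A" "q \<in> ?A" "p \<noteq> q"
      have "p = q" if "zs \<in> ?s p" "zs \<in> ?s q" for zs
      proof -
        have "map Inl (fst p) = (map Inl (fst q) :: ('v + 'w) list)" "map Inr (snd p) = (map Inr (snd q) :: ('v + 'w) list)"
          using filter_shuffles_sum[of zs "fst p" "snd p"] filter_shuffles_sum[of zs "fst q" "snd q"] that
          by (simp_all add: case_prod_beta)
        then show ?thesis by (simp add: prod_eq_iff inj_map_eq_map)
      qed
      then show "?s p \<inter> ?s q = {}" using \<open>p \<noteq> q\<close> by blast
    qed
  qed
  also have "\<dots> = (\<Sum>p\<in>?A. (card (verts P) + card (verts Q)) choose card (verts P))"
  proof (rule sum.cong[OF refl])
    fix p assume p: "p \<in> ?A"
    have "length (fst p) = card (verts P)" "length (snd p) = card (verts Q)"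
      using p by (auto simp: extension_lists_def dest: distinct_card)
    moreover have "set (map Inl (fst p)) \<inter> set (map Inr (snd p)) = {}" by auto
    ultimately show "card (?s p) = (card (verts P) + card (verts Q)) choose card (verts P)"
      using card_disjoint_shuffles[of "map Inl (fst p)" "map Inr (snd p)"] by (simp add: case_prod_beta)
  qed
  finally show ?thesis
    by (simp add: card_extension_lists assms finite_quiver_disj_union card_cartesian_product)
qed

lemma e0_quiver_disj_union:
  fixes P :: "('v, 'e, 'k::field_char_0) quiver" and Q :: "('w, 'f, 'k) quiver"
  assumes P: "finite_quiver P" and Q: "finite_quiver Q"
  shows "e0_quiver (disj_union P Q) = e0_quiver P * e0_quiver Q"
proof -
  have ac: "acyclic (adj (disj_union P Q)) \<longleftrightarrow> acyclic (adj P) \<and> acyclic (adj Q)"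
    unfolding acyclic_iff_rtrancl adj_disj_union ball_Un ball_simps
    by (auto simp: rtrancl_Plus split: prod.splits)
  have fin: "finite (verts P)" "finite (verts Q)" using assms by (auto simp: finite_quiver_def)
  let ?n = "card (verts P)" and ?m = "card (verts Q)"
  have "card (verts (disj_union P Q)) = ?n + ?m"
    by (simp add: card_Plus fin)
  moreover have "of_nat ((?n + ?m) choose ?n) = fact (?n + ?m) / (fact ?n * fact ?m :: 'k)"
    using binomial_fact[of ?n "?n + ?m", where 'a = 'k] by simp
  ultimately show ?thesis
    unfolding e0_quiver_def ac card_linear_extensions_disj_union[OF assms] by simp
qed

lemma e_quiver_disj_union:
  fixes P :: "('v, 'e, 'k::field_char_0) quiver" and Q :: "('w, 'f, 'k) quiver"
  assumes P: "finite_quiver P" and Q: "finite_quiver Q"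
  shows "e_quiver (disj_union P Q) = e_quiver P * e_quiver Q"
proof -
  have tad: "tadpoles (disj_union P Q) = tadpoles P <+> tadpoles Q"
    unfolding tadpoles_def by (auto simp: fst_map_prod snd_map_prod)
  have "quiver_iso (pruned (disj_union P Q)) (disj_union (pruned P) (pruned Q))"
    by (rule quiver_isoI[of id _ _ id])
      (auto simp: pruned_def tad prod.map_id0 bij_betw_def)
  then have "e0_quiver (pruned (disj_union P Q)) = e0_quiver (pruned P) * e0_quiver (pruned Q)"
    using assms by (subst e0_quiver_iso[of _ "disj_union (pruned P) (pruned Q)"])
      (auto intro!: finite_quiver_pruned finite_quiver_disj_union e0_quiver_disj_union)
  moreover have "finite (tadpoles P)" "finite (tadpoles Q)"
    using assms by (auto simp: tadpoles_def finite_quiver_def)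
  ultimately show ?thesis
    unfolding e_quiver_def tad by (simp add: prod.Plus)
qed

section \<open>Inverting the one-vertex quiver\<close>

lifting_forget qclass.lifting

definition bullet :: "'k qclass" where
  "bullet = iso_class (bullet_quiver :: (unit, unit, 'k) quiver)"

primrec bullets :: "nat \<Rightarrow> 'k qclass" where
  "bullets 0 = 0"
| "bullets (Suc n) = bullet + bullets n"

lemma bullets_add: "bullets (m + n) = bullets m + bullets n"
  by (induction m) (simp_all add: ac_simps)

text \<open>The localization of the monoid of isomorphism classes at \<open>bullet\<close>: the pair \<open>(G, n)\<close> stands
  for the product of \<open>G\<close> with the \<open>n\<close>-th power of the inverse of \<open>bullet\<close>.\<close>

quotient_type 'k qfrac = "'k qclass \<times> nat" /
  "\<lambda>(G, m) (H, n). \<exists>k. G + bullets (n + k) = H + bullets (m + k)"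
proof (rule equivpI)
  show "reflp (\<lambda>(G :: 'k qclass, m) (H, n). \<exists>k. G + bullets (n + k) = H + bullets (m + k))"
    by (auto intro!: reflpI)
  show "symp (\<lambda>(G :: 'k qclass, m) (H, n). \<exists>k. G + bullets (n + k) = H + bullets (m + k))"
    by (auto intro!: sympI dest: sym)
  show "transp (\<lambda>(G :: 'k qclass, m) (H, n). \<exists>k. G + bullets (n + k) = H + bullets (m + k))"
  proof (rule transpI, clarify)
    fix F G H :: "'k qclass" and l m n k k'
    assume 1: "F + bullets (m + k) = G + bullets (l + k)" and 2: "G + bullets (n + k') = H + bullets (m + k')"
    have "F + bullets (n + (m + k + k')) = (F + bullets (m + k)) + bullets (n + k')"
      by (simp add: bullets_add ac_simps)
    also have "\<dots> = (G + bullets (n + k')) + bullets (l + k)"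
      unfolding 1 by (simp add: ac_simps)
    also have "\<dots> = H + bullets (l + (m + k + k'))"
      unfolding 2 by (simp add: bullets_add ac_simps)
    finally show "\<exists>k. F + bullets (n + k) = H + bullets (l + k)" by blast
  qed
qed

lift_definition mk_qfrac :: "'k qclass \<Rightarrow> nat \<Rightarrow> 'k qfrac" is "\<lambda>G n. (G, n)" .

lemma frac_eq_iff: "mk_qfrac G m = mk_qfrac H n \<longleftrightarrow> (\<exists>k. G + bullets (n + k) = H + bullets (m + k))"
  by transfer simp

lemma ex_mk_qfrac: "\<exists>G n. x = mk_qfrac G n"
  by (induction x rule: qfrac.abs_induct) (auto simp: mk_qfrac.abs_eq split_paired_all)

lemma frac_bullet: "mk_qfrac (G + bullet) (Suc n) = mk_qfrac G n"
  unfolding frac_eq_iff by (rule exI[of _ 0]) (simp add: ac_simps)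

instantiation qfrac :: (type) comm_monoid_add
begin

lift_definition zero_qfrac :: "'a qfrac" is "(0, 0)" .

lift_definition plus_qfrac :: "'a qfrac \<Rightarrow> 'a qfrac \<Rightarrow> 'a qfrac" is
  "\<lambda>(G, m) (H, n). (G + H, m + n)"
proof clarify
  fix G G' H H' :: "'a qclass" and m m' n n' k l
  assume 1: "G + bullets (m' + k) = G' + bullets (m + k)" and 2: "H + bullets (n' + l) = H' + bullets (n + l)"
  have "G + H + bullets (m' + n' + (k + l)) = (G + bullets (m' + k)) + (H + bullets (n' + l))"
    by (simp add: bullets_add ac_simps)
  also have "\<dots> = G' + H' + bullets (m + n + (k + l))"
    unfolding 1 2 by (simp add: bullets_add ac_simps)
  finally show "\<exists>k. G + H + bullets (m' + n' + k) = G' + H' + bullets (m + n + k)" by blast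
qed

instance
  by (intro_classes; transfer) (auto simp: ac_simps)

end

lemma frac_add: "mk_qfrac G m + mk_qfrac H n = mk_qfrac (G + H) (m + n)"
  by transfer (auto simp: ac_simps)

lemma frac_zero: "mk_qfrac 0 0 = 0"
  by transfer auto

text \<open>A function on isomorphism classes and exponents that does not change when a one-vertex quiver
  and its inverse are added is well defined on the localization.\<close>

lemma frac_invariant:
  fixes G H :: "'k qclass"
  assumes f: "\<And>(G :: 'k qclass) n. f (G + bullet) (Suc n) = f G n"
    and "\<exists>k. G + bullets (n + k) = H + bullets (m + k)"
  shows "f G m = f H n"
proof -
  have *: "f (G + bullets k) (n + k) = f G n" for G :: "'k qclass" and n k
  proof (induction k)
    case (Suc k)
    then show ?case using f[of "G + bullets k" "n + k"] by (simp add: ac_simps)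
  qed simp
  obtain k where k: "G + bullets (n + k) = H + bullets (m + k)" using assms(2) by blast
  have "f G m = f (G + bullets (n + k)) (m + (n + k))" by (simp add: *)
  also have "\<dots> = f (H + bullets (m + k)) (n + (m + k))" unfolding k by (simp add: ac_simps)
  also have "\<dots> = f H n" by (simp add: *)
  finally show ?thesis .
qed

section \<open>Functions on isomorphism classes\<close>

lemma sum_cuts_rep: "finite_quiver Q \<Longrightarrow> sum_cuts (rep_qclass (iso_class Q)) \<phi> = sum_cuts Q \<phi>"
  by (intro sum_cuts_iso finite_rep_qclass rep_iso_class)

lemma e_quiver_rep: "finite_quiver Q \<Longrightarrow> e_quiver (rep_qclass (iso_class Q)) = e_quiver Q"
  by (intro e_quiver_iso finite_rep_qclass rep_iso_class)

lemma edges_rep: "finite_quiver Q \<Longrightarrow> edges (rep_qclass (iso_class Q)) = {} \<longleftrightarrow> edges Q = {}"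
  using rep_iso_class[of Q] by (auto simp: quiver_iso_def bij_betw_def)

lemma sum_cuts_rep_add:
  "sum_cuts (rep_qclass (c + d)) \<phi> =
    sum_cuts (rep_qclass c) (\<lambda>h k. sum_cuts (rep_qclass d) (\<lambda>h' k'. \<phi> (h + h') (k + k')))"
  using sum_cuts_disj_union[OF finite_rep_qclass finite_rep_qclass, of c d \<phi>]
    sum_cuts_rep[OF finite_quiver_disj_union[OF finite_rep_qclass finite_rep_qclass], of c d \<phi>]
  by (simp add: plus_qclass_def)

lemma e_quiver_rep_add: "e_quiver (rep_qclass (c + d)) = e_quiver (rep_qclass c) * e_quiver (rep_qclass d)"
  using e_quiver_disj_union[OF finite_rep_qclass finite_rep_qclass, of c d]
    e_quiver_rep[OF finite_quiver_disj_union[OF finite_rep_qclass finite_rep_qclass], of c d]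
  by (simp add: plus_qclass_def)

lemma edges_rep_add: "edges (rep_qclass (c + d)) = {} \<longleftrightarrow> edges (rep_qclass c) = {} \<and> edges (rep_qclass d) = {}"
  using edges_rep[OF finite_quiver_disj_union[OF finite_rep_qclass finite_rep_qclass], of c d]
  by (simp add: plus_qclass_def)

lemma finite_bullet_quiver: "finite_quiver bullet_quiver"
  by (simp add: finite_quiver_def bullet_quiver_def)

lemma finite_empty_quiver: "finite_quiver empty_quiver"
  by (simp add: finite_quiver_def empty_quiver_def)

lemma iso_class_no_edges:
  assumes "finite_quiver Q" "edges Q = {}"
  shows "iso_class (cut_subquiver Q {}) = iso_class Q" "iso_class (contract Q {}) = iso_class Q"
proof -
  show "iso_class (cut_subquiver Q {}) = iso_class Q"
    using assms(2) by (cases Q) (simp add: cut_subquiver_def)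
  have c: "connectivity (cut_subquiver Q {}) `` {v} = {v}" if "v \<in> verts Q" for v
    using that by (auto simp: connectivity_def adj_def cut_subquiver_def)
  have "components (cut_subquiver Q {}) = (\<lambda>v. {v}) ` verts Q"
    unfolding components_eq by (intro image_cong) (simp_all add: c, simp add: cut_subquiver_def)
  then have "quiver_iso Q (contract Q {})"
    by (intro quiver_isoI[of "\<lambda>v. {v}" _ _ id])
      (use assms(2) in \<open>auto simp: contract_def Let_def bij_betw_def\<close>)
  then show "iso_class (contract Q {}) = iso_class Q"
    by (intro iso_class_eqI[symmetric] assms(1) finite_quiver_contract)
qed

lemma sum_cuts_no_edges:
  assumes "finite_quiver Q" "edges Q = {}"
  shows "sum_cuts (rep_qclass (iso_class Q)) \<phi> = \<phi> (iso_class Q) (iso_class Q)"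
  unfolding sum_cuts_rep[OF assms(1)]
  unfolding sum_cuts_def assms(2) by (simp add: iso_class_no_edges[OF assms])

lemma edges_bullet_quiver: "edges bullet_quiver = {}"
  by (simp add: bullet_quiver_def)

lemma edges_empty_quiver: "edges empty_quiver = {}"
  by (simp add: empty_quiver_def)

lemma sum_cuts_bullet: "sum_cuts (rep_qclass bullet) \<phi> = \<phi> bullet bullet"
  unfolding bullet_def by (intro sum_cuts_no_edges finite_bullet_quiver edges_bullet_quiver)

lemma sum_cuts_zero: "sum_cuts (rep_qclass 0) \<phi> = \<phi> 0 0"
  unfolding zero_qclass_def by (intro sum_cuts_no_edges finite_empty_quiver edges_empty_quiver)

lemma linear_extensions_le1:
  assumes "verts Q \<subseteq> {v}" "edges Q = {}"
  shows "linear_extensions Q = {Id_on (verts Q)}"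
proof -
  have "r = Id_on (verts Q)" if "linear_order_on (verts Q) r" for r
    using that assms(1) unfolding order_on_defs refl_on_def by auto
  moreover have "linear_order_on (verts Q) (Id_on (verts Q))"
    using assms(1) unfolding order_on_defs refl_on_def total_on_def
    by (auto simp: trans_Id_on antisym_Id_on)
  moreover have "edge_order Q \<subseteq> Id_on (verts Q)"
    using assms(2) by (auto simp: edge_order_def adj_def)
  ultimately show ?thesis unfolding linear_extensions_def by blast
qed

lemma e_quiver_le1:
  assumes "verts Q \<subseteq> {v}" "edges Q = {}"
  shows "e_quiver Q = 1"
proof -
  have "tadpoles Q = {}" "pruned Q = Q"
    using assms(2) by (cases Q; simp add: tadpoles_def pruned_def)+
  moreover have "adj Q = {}" using assms(2) by (simp add: adj_def)
  moreover have "card (verts Q) = 0 \<or> card (verts Q) = 1" using assms(1) by (auto simp: subset_singleton_iff)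
  ultimately show ?thesis
    using linear_extensions_le1[OF assms] by (auto simp: e_quiver_def e0_quiver_def acyclic_def)
qed

lemma e_quiver_bullet: "e_quiver (rep_qclass bullet) = (1 :: 'k::field_char_0)"
  unfolding bullet_def e_quiver_rep[OF finite_bullet_quiver]
  by (rule e_quiver_le1[of _ "()"]) (auto simp: bullet_quiver_def)

lemma e_quiver_zero: "e_quiver (rep_qclass 0) = (1 :: 'k::field_char_0)"
  unfolding zero_qclass_def e_quiver_rep[OF finite_empty_quiver]
  by (rule e_quiver_le1[of _ undefined]) (auto simp: empty_quiver_def)

lemma edges_bullet: "edges (rep_qclass bullet) = {}"
  unfolding bullet_def edges_rep[OF finite_bullet_quiver] by (rule edges_bullet_quiver)

lemma edges_zero: "edges (rep_qclass 0) = {}"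
  unfolding zero_qclass_def edges_rep[OF finite_empty_quiver] by (rule edges_empty_quiver)

section \<open>The Hopf algebra\<close>

text \<open>\<open>'k hopf\<close> is the monoid algebra of the localized monoid of isomorphism classes; as is shown below,
  it is the localization at \<open>bullet\<close> of the monoid algebra of \<open>'k qclass\<close>.  The tensor square of a free
  module has the pairs of basis elements as a basis: \<open>a \<otimes> b\<close> is the pair \<open>(a, b)\<close>.\<close>

type_synonym 'k hopf = "'k qfrac \<Rightarrow>\<^sub>0 'k"
type_synonym 'k hopf2 = "'k qfrac \<times> 'k qfrac \<Rightarrow>\<^sub>0 'k"

abbreviation scale :: "'k::comm_ring_1 \<Rightarrow> ('b \<Rightarrow>\<^sub>0 'k) \<Rightarrow> ('b \<Rightarrow>\<^sub>0 'k)" where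
  "scale c \<equiv> Poly_Mapping.map ((*) c)"

text \<open>The linear extension of a function \<open>\<phi>\<close> on the basis, for a module with scalar
  multiplication \<open>s\<close>.\<close>

definition lin_ext ::
  "('k::comm_ring_1 \<Rightarrow> 'a::ab_group_add \<Rightarrow> 'a) \<Rightarrow> ('b \<Rightarrow> 'a) \<Rightarrow> ('b \<Rightarrow>\<^sub>0 'k) \<Rightarrow> 'a" where
  "lin_ext s \<phi> x = (\<Sum>b\<in>Poly_Mapping.keys x. s (Poly_Mapping.lookup x b) (\<phi> b))"

definition quiver_elem :: "('v, 'e, 'k::field_char_0) quiver \<Rightarrow> 'k hopf" where
  "quiver_elem Q = Poly_Mapping.single (mk_qfrac (iso_class Q) 0) 1"

definition bullet_inverse :: "'k::field_char_0 hopf" where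
  "bullet_inverse = Poly_Mapping.single (mk_qfrac 0 1) 1"

text \<open>The coproduct, counit and \<open>e\<close> on the basis elements \<open>G bullet\<^sup>-\<^sup>n\<close>, evaluated on a representative of \<open>G\<close>;
  \<open>coproduct_single\<close>, \<open>counit_single\<close> and \<open>e_char_single\<close> below give the values for
  arbitrary finite quivers.\<close>

lift_definition coproduct_frac :: "'k::field_char_0 qfrac \<Rightarrow> 'k hopf2" is
  "\<lambda>(G, n). sum_cuts (rep_qclass G) (\<lambda>h k. Poly_Mapping.single (mk_qfrac h n, mk_qfrac k n) 1)"
  by clarify (rule frac_invariant
      [where f = "\<lambda>G n. sum_cuts (rep_qclass G) (\<lambda>h k. Poly_Mapping.single (mk_qfrac h n, mk_qfrac k n) 1)"],
    auto simp: sum_cuts_rep_add sum_cuts_bullet frac_bullet)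

lift_definition counit_frac :: "'k::field_char_0 qfrac \<Rightarrow> 'k" is
  "\<lambda>(G, n). if edges (rep_qclass G) = {} then 1 else 0"
  by clarify (rule frac_invariant[where f = "\<lambda>G n. if edges (rep_qclass G) = {} then 1 else 0"],
    auto simp: edges_rep_add edges_bullet)

lift_definition e_frac :: "'k::field_char_0 qfrac \<Rightarrow> 'k" is
  "\<lambda>(G, n). e_quiver (rep_qclass G)"
  by clarify (rule frac_invariant[where f = "\<lambda>G n. e_quiver (rep_qclass G)"],
    auto simp: e_quiver_rep_add e_quiver_bullet)

definition coproduct :: "'k::field_char_0 hopf \<Rightarrow> 'k hopf2" where
  "coproduct = lin_ext scale coproduct_frac"

definition counit :: "'k::field_char_0 hopf \<Rightarrow> 'k" where
  "counit = lin_ext (*) counit_frac"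

definition e_char :: "'k::field_char_0 hopf \<Rightarrow> 'k" where
  "e_char = lin_ext (*) e_frac"

text \<open>\<open>m\<^sub>A \<circ> (f \<otimes> g) \<circ> coproduct\<close> for linear functions \<open>f\<close> and \<open>g\<close> into an algebra \<open>A\<close> with scalar
  multiplication \<open>s\<close>.\<close>

definition convolution ::
  "('k::field_char_0 \<Rightarrow> 'a::comm_ring_1 \<Rightarrow> 'a) \<Rightarrow> ('k hopf \<Rightarrow> 'a) \<Rightarrow> ('k hopf \<Rightarrow> 'a) \<Rightarrow> 'k hopf \<Rightarrow> 'a" where
  "convolution s f g =
     lin_ext s (\<lambda>(a, b). f (Poly_Mapping.single a 1) * g (Poly_Mapping.single b 1)) \<circ> coproduct"

definition is_antipode :: "('k::field_char_0 hopf \<Rightarrow> 'k hopf) \<Rightarrow> bool" where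
  "is_antipode S \<longleftrightarrow> Vector_Spaces.linear scale scale S \<and>
     convolution scale S id = (\<lambda>x. scale (counit x) 1) \<and>
     convolution scale id S = (\<lambda>x. scale (counit x) 1)"

definition antipode :: "'k::field_char_0 hopf \<Rightarrow> 'k hopf" where
  "antipode = (THE S. is_antipode S)"

definition omega :: "'k::field_char_0 hopf \<Rightarrow> 'k" where
  "omega = (THE w. Vector_Spaces.linear scale (*) w \<and> convolution (*) w e_char = counit)"

definition is_character :: "('k::field_char_0 hopf \<Rightarrow> 'k) \<Rightarrow> bool" where
  "is_character f \<longleftrightarrow>
     Vector_Spaces.linear scale (*) f \<and> f 1 = 1 \<and> (\<forall>x y. f (x * y) = f x * f y)"

lemma lookup_scale: "Poly_Mapping.lookup (scale c x) b = c * Poly_Mapping.lookup x b"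
  by (simp add: Poly_Mapping.map.rep_eq when_def)

lemma vector_space_scale: "vector_space (scale :: 'k::field \<Rightarrow> ('b \<Rightarrow>\<^sub>0 'k) \<Rightarrow> _)"
  by unfold_locales (auto intro!: poly_mapping_eqI simp: lookup_scale lookup_add algebra_simps)

lemma vector_space_mult: "vector_space ((*) :: 'k::field \<Rightarrow> 'k \<Rightarrow> 'k)"
  by unfold_locales (auto simp: algebra_simps)

lemma linear_lin_ext:
  assumes "vector_space (s :: 'k::field \<Rightarrow> 'a::ab_group_add \<Rightarrow> 'a)"
  shows "Vector_Spaces.linear scale s (lin_ext s \<phi> :: ('b \<Rightarrow>\<^sub>0 'k) \<Rightarrow> 'a)"
proof -
  interpret vector_space s by (rule assms)
  have super: "lin_ext s \<phi> x = (\<Sum>b\<in>B. s (Poly_Mapping.lookup x b) (\<phi> b))"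
    if "finite B" "Poly_Mapping.keys x \<subseteq> B" for B and x :: "'b \<Rightarrow>\<^sub>0 'k"
    unfolding lin_ext_def using that by (intro sum.mono_neutral_left) (auto simp: in_keys_iff)
  have "module_hom scale s (lin_ext s \<phi> :: ('b \<Rightarrow>\<^sub>0 'k) \<Rightarrow> 'a)"
  proof (intro module_hom.intro module_hom_axioms.intro)
    show "module (scale :: 'k \<Rightarrow> ('b \<Rightarrow>\<^sub>0 'k) \<Rightarrow> _)"
      using vector_space_scale by (simp add: module_iff_vector_space)
    show "module s" using assms by (simp add: module_iff_vector_space)
    fix x y :: "'b \<Rightarrow>\<^sub>0 'k" and c :: 'k
    let ?B = "Poly_Mapping.keys x \<union> Poly_Mapping.keys y"
    have "Poly_Mapping.keys (x + y) \<subseteq> ?B" by (rule keys_add)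
    then show "lin_ext s \<phi> (x + y) = lin_ext s \<phi> x + lin_ext s \<phi> y"
      by (simp add: super[of ?B] lookup_add scale_left_distrib sum.distrib)
    have "Poly_Mapping.keys (scale c x) \<subseteq> Poly_Mapping.keys x"
      by (auto simp: in_keys_iff lookup_scale)
    then show "lin_ext s \<phi> (scale c x) = s c (lin_ext s \<phi> x)"
      by (simp add: super[of "Poly_Mapping.keys x"] lookup_scale scale_sum_right)
  qed
  then show ?thesis by (simp add: module_hom_iff_linear)
qed

lemma lin_ext_single:
  assumes "vector_space s"
  shows "lin_ext s \<phi> (Poly_Mapping.single b 1) = \<phi> b"
proof -
  interpret vector_space s by (rule assms)
  show ?thesis by (simp add: lin_ext_def)
qed

lemma poly_mapping_expand:
  fixes x :: "'b \<Rightarrow>\<^sub>0 'k::comm_ring_1"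
  shows "x = (\<Sum>b\<in>Poly_Mapping.keys x. scale (Poly_Mapping.lookup x b) (Poly_Mapping.single b 1))"
  by (rule poly_mapping_eqI) (auto simp: lookup_sum lookup_scale lookup_single when_def in_keys_iff)

lemma linear_eqI:
  fixes f g :: "('b \<Rightarrow>\<^sub>0 'k::field) \<Rightarrow> 'a::ab_group_add"
  assumes "Vector_Spaces.linear scale s f" "Vector_Spaces.linear scale s g"
    and eq: "\<And>b. f (Poly_Mapping.single b 1) = g (Poly_Mapping.single b 1)"
  shows "f = g"
proof
  fix x :: "'b \<Rightarrow>\<^sub>0 'k"
  interpret f: Vector_Spaces.linear scale s f by (rule assms(1))
  interpret g: Vector_Spaces.linear scale s g by (rule assms(2))
  show "f x = g x"
    by (subst (1 2) poly_mapping_expand[of x]) (simp add: f.sum g.sum f.scale g.scale eq del: Poly_Mapping.map_single)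
qed

lemma lin_ext_mult:
  fixes s :: "'k::field \<Rightarrow> 'a::comm_ring_1 \<Rightarrow> 'a" and x y :: "('b::comm_monoid_add) \<Rightarrow>\<^sub>0 'k"
  assumes "vector_space s" and s: "\<And>c u v. s c (u * v) = s c u * v"
    and \<phi>: "\<And>a b. \<phi> (a + b) = \<phi> a * \<phi> b"
  shows "lin_ext s \<phi> (x * y) = lin_ext s \<phi> x * lin_ext s \<phi> y"
proof -
  interpret vector_space s by (rule assms(1))
  interpret L: Vector_Spaces.linear scale s "lin_ext s \<phi> :: ('b \<Rightarrow>\<^sub>0 'k) \<Rightarrow> 'a"
    by (rule linear_lin_ext[OF assms(1)])
  let ?x = "Poly_Mapping.lookup x" and ?y = "Poly_Mapping.lookup y"
  have s': "s c u * s d v = s (c * d) (u * v)" for c d u v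
    by (metis mult.commute s scale_scale)
  have scale': "scale c u * scale d v = scale (c * d) (u * v)" for c d and u v :: "'b \<Rightarrow>\<^sub>0 'k"
  proof -
    have "Poly_Mapping.single 0 (c * d) = (Poly_Mapping.single 0 c * Poly_Mapping.single 0 d :: 'b \<Rightarrow>\<^sub>0 'k)"
      by (simp add: mult_single)
    then show ?thesis by (simp only: mult_map_scale_conv_mult ac_simps)
  qed
  have "x * y = (\<Sum>a\<in>Poly_Mapping.keys x. \<Sum>b\<in>Poly_Mapping.keys y. scale (?x a * ?y b) (Poly_Mapping.single (a + b) 1))"
    by (subst (1) poly_mapping_expand[of x], subst (1) poly_mapping_expand[of y])
      (simp add: sum_product scale' mult_single del: Poly_Mapping.map_single)
  then have "lin_ext s \<phi> (x * y) = (\<Sum>a\<in>Poly_Mapping.keys x. \<Sum>b\<in>Poly_Mapping.keys y. s (?x a * ?y b) (\<phi> (a + b)))"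
    by (simp add: L.sum L.scale lin_ext_single[OF assms(1)] del: Poly_Mapping.map_single)
  also have "\<dots> = lin_ext s \<phi> x * lin_ext s \<phi> y"
    unfolding lin_ext_def sum_product by (simp add: s' \<phi>)
  finally show ?thesis .
qed

lemma counit_single: "finite_quiver Q \<Longrightarrow>
    counit (Poly_Mapping.single (mk_qfrac (iso_class Q) n) 1) = (if edges Q = {} then 1 else 0)"
  unfolding counit_def lin_ext_single[OF vector_space_mult] by transfer (simp add: edges_rep)

lemma e_char_single: "finite_quiver Q \<Longrightarrow> e_char (Poly_Mapping.single (mk_qfrac (iso_class Q) n) 1) = e_quiver Q"
  unfolding e_char_def lin_ext_single[OF vector_space_mult] by transfer (simp add: e_quiver_rep)

lemma coproduct_frac_mk:
  "coproduct_frac (mk_qfrac G n) =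
    sum_cuts (rep_qclass G) (\<lambda>h k. Poly_Mapping.single (mk_qfrac h n, mk_qfrac k n) 1)"
  by (subst mk_qfrac.abs_eq, subst coproduct_frac.abs_eq) simp

lemma coproduct_single:
  assumes "finite_quiver Q"
  shows "coproduct (Poly_Mapping.single (mk_qfrac (iso_class Q) n) 1) =
    (\<Sum>F\<in>Pow (edges Q). Poly_Mapping.single
       (mk_qfrac (iso_class (cut_subquiver Q F)) n, mk_qfrac (iso_class (contract Q F)) n) 1)"
  unfolding coproduct_def lin_ext_single[OF vector_space_scale] coproduct_frac_mk
  using assms by (simp add: sum_cuts_rep sum_cuts_def[of Q])

lemma e_char_is_character: "is_character (e_char :: 'k::field_char_0 hopf \<Rightarrow> 'k)"
proof -
  have "e_frac (x + y) = (e_frac x * e_frac y :: 'k)" for x y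
    by transfer (auto simp: e_quiver_rep_add)
  moreover have "e_frac 0 = (1 :: 'k)" by transfer (simp add: e_quiver_zero)
  ultimately show ?thesis
    unfolding is_character_def e_char_def
    by (auto intro!: linear_lin_ext lin_ext_mult vector_space_mult
        simp: lin_ext_single[OF vector_space_mult] simp flip: single_one)
qed

lemma e_char_bullet_inverse: "e_char bullet_inverse = 1"
  unfolding bullet_inverse_def zero_qclass_def e_char_single[OF finite_empty_quiver]
  using e_quiver_rep[OF finite_empty_quiver] e_quiver_zero by (metis zero_qclass_def)

lemma coproduct_mult: "coproduct (x * y) = coproduct x * coproduct y"
proof -
  have "coproduct_frac (x + y) = (coproduct_frac x * coproduct_frac y :: 'a hopf2)" for x y
  proof -
    obtain G m H n where "x = mk_qfrac G m" "y = mk_qfrac H n" using ex_mk_qfrac by metis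
    then show ?thesis
      by (simp add: frac_add coproduct_frac_mk sum_cuts_rep_add)
        (simp add: sum_cuts_def sum_product mult_single flip: frac_add)
  qed
  moreover have "scale c (u * v) = scale c u * v" for c and u v :: "'a hopf2"
    by (simp add: mult_map_scale_conv_mult ac_simps)
  ultimately show ?thesis
    unfolding coproduct_def by (intro lin_ext_mult vector_space_scale)
qed

lemma quiver_elem_disj_union:
  assumes "finite_quiver P" "finite_quiver Q"
  shows "quiver_elem (disj_union P Q) = quiver_elem P * quiver_elem Q"
  unfolding quiver_elem_def by (simp add: iso_class_disj_union assms mult_single frac_add)

lemma quiver_elem_empty: "quiver_elem (empty_quiver :: (nat, nat, 'k::field_char_0) quiver) = 1"
  unfolding quiver_elem_def zero_qclass_def[symmetric] frac_zero by simp

lemma quiver_elem_bullet: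
  "quiver_elem (bullet_quiver :: (unit, unit, 'k::field_char_0) quiver) * bullet_inverse = 1"
  using frac_bullet[of "0 :: 'k qclass" 0]
  unfolding quiver_elem_def bullet_inverse_def bullet_def[symmetric]
  by (simp add: mult_single frac_add frac_zero)

lemma coproduct_bullet_inverse:
  "coproduct (bullet_inverse :: 'k::field_char_0 hopf) = Poly_Mapping.single (mk_qfrac 0 1, mk_qfrac 0 1) 1"
  unfolding bullet_inverse_def coproduct_def lin_ext_single[OF vector_space_scale] coproduct_frac_mk sum_cuts_zero ..

text \<open>The next lemmas show that \<open>'k hopf\<close> is the localization at \<open>bullet\<close> of the algebra with basis
  the isomorphism classes.\<close>

definition embed_gdir :: "('k::field_char_0 qclass \<Rightarrow>\<^sub>0 'k) \<Rightarrow> 'k hopf" where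
  "embed_gdir = lin_ext scale (\<lambda>G. Poly_Mapping.single (mk_qfrac G 0) 1)"

lemma linear_embed_gdir: "Vector_Spaces.linear scale scale embed_gdir"
  unfolding embed_gdir_def by (intro linear_lin_ext vector_space_scale)

lemma embed_gdir_one: "embed_gdir 1 = 1"
  unfolding embed_gdir_def single_one[symmetric] lin_ext_single[OF vector_space_scale] frac_zero ..

lemma embed_gdir_mult: "embed_gdir (x * y) = embed_gdir x * embed_gdir y"
  unfolding embed_gdir_def
  by (intro lin_ext_mult vector_space_scale)
    (simp_all add: mult_map_scale_conv_mult ac_simps mult_single frac_add)

lemma bullet_inverse_power: "bullet_inverse ^ n = Poly_Mapping.single (mk_qfrac 0 n) 1"
  by (induction n) (simp_all add: frac_zero bullet_inverse_def mult_single frac_add)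

lemma bullet_power: "Poly_Mapping.single bullet (1 :: 'k::comm_ring_1) ^ n = Poly_Mapping.single (bullets n) 1"
  by (induction n) (simp_all add: mult_single)

lemma embed_gdir_surj: "\<exists>a n. (x :: 'k::field_char_0 hopf) = embed_gdir a * bullet_inverse ^ n"
proof -
  obtain g m where gm: "\<And>b :: 'k qfrac. b = mk_qfrac (g b) (m b)" using ex_mk_qfrac by metis
  interpret E: Vector_Spaces.linear scale scale "embed_gdir :: _ \<Rightarrow> 'k hopf" by (rule linear_embed_gdir)
  define N where "N = (\<Sum>b\<in>Poly_Mapping.keys x. m b)"
  define a where "a = (\<Sum>b\<in>Poly_Mapping.keys x.
    scale (Poly_Mapping.lookup x b) (Poly_Mapping.single (g b + bullets (N - m b)) (1 :: 'k)))"
  have b: "mk_qfrac (g b + bullets (N - m b)) N = b" if "b \<in> Poly_Mapping.keys x" for b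
  proof -
    have "m b \<le> N" unfolding N_def using that by (intro member_le_sum) auto
    then have "mk_qfrac (g b + bullets (N - m b)) N = mk_qfrac (g b) (m b)"
      unfolding frac_eq_iff by (intro exI[of _ 0]) (simp add: ac_simps flip: bullets_add)
    then show ?thesis using gm by metis
  qed
  have "embed_gdir a * bullet_inverse ^ N = (\<Sum>b\<in>Poly_Mapping.keys x.
      scale (Poly_Mapping.lookup x b) (Poly_Mapping.single (mk_qfrac (g b + bullets (N - m b)) N) 1))"
    unfolding a_def E.sum E.scale sum_distrib_right bullet_inverse_power
    by (simp add: embed_gdir_def lin_ext_single[OF vector_space_scale] mult_single frac_add)
  also have "\<dots> = (\<Sum>b\<in>Poly_Mapping.keys x. scale (Poly_Mapping.lookup x b) (Poly_Mapping.single b 1))"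
    by (intro sum.cong refl) (simp add: b)
  also have "\<dots> = x" by (rule poly_mapping_expand[symmetric])
  finally show ?thesis by metis
qed

lemma lookup_lin_ext_single:
  "Poly_Mapping.lookup (lin_ext scale (\<lambda>b. Poly_Mapping.single (\<phi> b) 1) x) y =
    (\<Sum>b | b \<in> Poly_Mapping.keys x \<and> \<phi> b = y. Poly_Mapping.lookup x b)"
  unfolding lin_ext_def
  by (simp add: lookup_sum lookup_scale lookup_single when_def sum.inter_filter if_distrib
      del: Poly_Mapping.map_single cong: if_cong)

lemma embed_gdir_eq_0_iff:
  "embed_gdir (a :: 'k::field_char_0 qclass \<Rightarrow>\<^sub>0 'k) = 0 \<longleftrightarrow> (\<exists>n. Poly_Mapping.single bullet 1 ^ n * a = 0)"
proof
  interpret E: Vector_Spaces.linear scale scale "embed_gdir :: _ \<Rightarrow> 'k hopf" by (rule linear_embed_gdir)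
  assume "\<exists>n. Poly_Mapping.single bullet 1 ^ n * a = 0"
  then obtain n where "Poly_Mapping.single (bullets n) 1 * a = 0" unfolding bullet_power by blast
  then have "Poly_Mapping.single (mk_qfrac (bullets n) 0) 1 * embed_gdir a = 0"
    by (metis E.zero embed_gdir_def embed_gdir_mult lin_ext_single vector_space_scale)
  then have "Poly_Mapping.single (mk_qfrac 0 n) 1 * (Poly_Mapping.single (mk_qfrac (bullets n) 0) 1 * embed_gdir a) = 0"
    by simp
  moreover have "mk_qfrac (bullets n) n = (0 :: 'k qfrac)"
    unfolding frac_zero[symmetric] frac_eq_iff by (intro exI[of _ 0]) simp
  ultimately show "embed_gdir a = 0"
    by (simp add: mult_single frac_add flip: mult.assoc)
next
  assume 0: "embed_gdir a = 0"
  let ?K = "Poly_Mapping.keys a"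
  have "\<exists>k. mk_qfrac G 0 = mk_qfrac H 0 \<longrightarrow> G + bullets k = H + bullets k" for G H :: "'k qclass"
    unfolding frac_eq_iff by auto
  then obtain k where k: "\<And>G H :: 'k qclass. mk_qfrac G 0 = mk_qfrac H 0 \<Longrightarrow> G + bullets (k G H) = H + bullets (k G H)"
    by metis
  define N where "N = (\<Sum>(G, H)\<in>?K \<times> ?K. k G H)"
  have N: "G + bullets N = H + bullets N \<longleftrightarrow> mk_qfrac G 0 = mk_qfrac H 0" if "G \<in> ?K" "H \<in> ?K" for G H
  proof
    assume "mk_qfrac G 0 = mk_qfrac H 0"
    moreover have "k G H \<le> N"
      unfolding N_def using member_le_sum[of "(G, H)" "?K \<times> ?K" "\<lambda>(G, H). k G H"] that by simp
    ultimately show "G + bullets N = H + bullets N"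
      using k[of G H] by (metis add.assoc bullets_add le_add_diff_inverse)
  qed (auto simp: frac_eq_iff)
  have "Poly_Mapping.single (bullets N) 1 * a =
      Poly_Mapping.single (bullets N) 1 * (\<Sum>G\<in>?K. scale (Poly_Mapping.lookup a G) (Poly_Mapping.single G 1))"
    using poly_mapping_expand[of a] by simp
  also have "\<dots> = lin_ext scale (\<lambda>G. Poly_Mapping.single (G + bullets N) 1) a"
    by (simp add: lin_ext_def sum_distrib_left mult_single ac_simps)
  finally have eq: "Poly_Mapping.single (bullets N) 1 * a = lin_ext scale (\<lambda>G. Poly_Mapping.single (G + bullets N) 1) a" .
  have "Poly_Mapping.single (bullets N) 1 * a = 0"
  proof (rule poly_mapping_eqI)
    fix y
    show "Poly_Mapping.lookup (Poly_Mapping.single (bullets N) 1 * a) y = Poly_Mapping.lookup 0 y"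
    proof (cases "\<exists>H\<in>?K. H + bullets N = y")
      case True
      then obtain H where H: "H \<in> ?K" "y = H + bullets N" by blast
      have "{G. G \<in> ?K \<and> G + bullets N = y} = {G. G \<in> ?K \<and> mk_qfrac G 0 = mk_qfrac H 0}"
        using N H by auto
      moreover have "(\<Sum>G | G \<in> ?K \<and> mk_qfrac G 0 = mk_qfrac H 0. Poly_Mapping.lookup a G) = 0"
        using 0 unfolding lookup_lin_ext_single[of "\<lambda>G. mk_qfrac G 0", symmetric] embed_gdir_def by simp
      ultimately show ?thesis
        unfolding eq lookup_lin_ext_single by simp
    next
      case False
      then have "{G. G \<in> ?K \<and> G + bullets N = y} = {}" by blast
      then show ?thesis unfolding eq lookup_lin_ext_single by (metis lookup_zero sum.empty)
    qed
  qed
  then show "\<exists>n. Poly_Mapping.single bullet 1 ^ n * a = 0" unfolding bullet_power by blast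
qed

end

theory Submission
  imports Defs
begin

text \<open>A linear function on the Hopf algebra is determined by its values on the basis \<open>'k qfrac\<close>, so the
  argument takes place among functions from this basis to a commutative ring \<open>R\<close>, under the
  convolution \<open>frac_conv\<close>.  This convolution is associative (\<open>frac_conv_assoc\<close>), since contracting
  first \<open>A\<close> and then a disjoint edge set \<open>B\<close> amounts to contracting \<open>A \<union> B\<close> (\<open>contract_contract_iso\<close>), and it has the
  counit \<open>frac_unit\<close> as its unit.

  Let \<open>g\<close> be multiplicative.  A quiver without edges is a disjoint union of one-vertex quivers, so it is
  invertible in the localized monoid and \<open>g\<close> takes a unit of \<open>R\<close> as its value there.  In the sum
  defining the convolution \<open>f * g\<close> at \<open>Q\<close>, the only term that involves \<open>f\<close> at a quiver with as many
  edges as \<open>Q\<close> comes from \<open>H = Q\<close>, and there \<open>Q/H\<close> has no edges.  Hence \<open>f * g = frac_unit\<close> has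
  a solution \<open>f\<close>, obtained by recursion on the number of edges (\<open>frac_conv_left_inverse\<close>).
  Comparing \<open>f * g\<close> at a disjoint union with the product of its values at the two parts shows, by
  induction on the number of edges, that \<open>f\<close> is again multiplicative
  (\<open>multiplicative_left_inverse\<close>).  So \<open>f\<close> in turn has a left inverse, and by associativity \<open>f\<close> is the
  two-sided inverse of \<open>g\<close> (\<open>multiplicative_inverse\<close>).

  For \<open>g\<close> the inclusion of the basis into the Hopf algebra, this gives the existence and uniqueness
  of the antipode \<open>S\<close>; for \<open>g = e\<close> it shows that \<open>omega\<close> is a two-sided inverse of \<open>e\<close> and a
  character.  Applying the algebra homomorphism \<open>e\<close> to the identity saying that \<open>S\<close> is a left
  convolution inverse of \<open>id\<close> shows that \<open>e \<circ> S\<close> is a left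
  inverse of \<open>e\<close>, hence equal to \<open>omega\<close>.\<close>

section \<open>Successive contractions\<close>

text \<open>If \<open>c\<close> collapses exactly the \<open>r\<close>-connected points, then a path along the image of \<open>s\<close> lifts to a
  path that alternates between \<open>s\<close>-steps and \<open>r\<close>-paths inside a class.\<close>

lemma rtrancl_quotient_iff:
  assumes sub: "r \<subseteq> V \<times> V" "s \<subseteq> V \<times> V"
    and c: "\<And>u v. u \<in> V \<Longrightarrow> v \<in> V \<Longrightarrow> c u = c v \<longleftrightarrow> (u, v) \<in> r\<^sup>*"
    and V: "u \<in> V" "v \<in> V"
  shows "(c u, c v) \<in> (map_prod c c ` s)\<^sup>* \<longleftrightarrow> (u, v) \<in> (r \<union> s)\<^sup>*"
proof
  have r: "r\<^sup>* \<subseteq> (r \<union> s)\<^sup>*" by (rule rtrancl_mono) simp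
  have "\<forall>w\<in>V. D = c w \<longrightarrow> (u, w) \<in> (r \<union> s)\<^sup>*" if "(c u, D) \<in> (map_prod c c ` s)\<^sup>*" for D
    using that
  proof (induction rule: rtrancl_induct)
    case base
    then show ?case using c V(1) r by blast
  next
    case (step D D')
    then obtain x y where xy: "(x, y) \<in> s" "D = c x" "D' = c y" by auto
    then have V': "x \<in> V" "y \<in> V" using sub(2) by auto
    have "(u, x) \<in> (r \<union> s)\<^sup>*" using step.IH xy(2) V'(1) by blast
    then have "(u, y) \<in> (r \<union> s)\<^sup>*" using xy(1) by (meson UnI2 rtrancl.rtrancl_into_rtrancl)
    moreover have "(y, w) \<in> (r \<union> s)\<^sup>*" if "w \<in> V" "D' = c w" for w
      using c[OF V'(2) that(1)] that(2) xy(3) r by auto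
    ultimately show ?case by (meson rtrancl_trans)
  qed
  then show "(c u, c v) \<in> (map_prod c c ` s)\<^sup>* \<Longrightarrow> (u, v) \<in> (r \<union> s)\<^sup>*"
    using V(2) by blast
next
  assume "(u, v) \<in> (r \<union> s)\<^sup>*"
  then show "(c u, c v) \<in> (map_prod c c ` s)\<^sup>*"
  proof (induction rule: rtrancl_induct)
    case (step x y)
    have xy: "x \<in> V" "y \<in> V" using step.hyps(2) sub by auto
    show ?case
    proof (cases "(x, y) \<in> s")
      case True
      then have "(c x, c y) \<in> map_prod c c ` s" by force
      with step.IH show ?thesis by (rule rtrancl.rtrancl_into_rtrancl)
    next
      case False
      then have "c x = c y" using c[OF xy] step.hyps(2) by auto
      with step.IH show ?thesis by simp
    qed
  qed simp
qed

lemma cut_cut: "cut_subquiver (cut_subquiver Q F) F' = cut_subquiver Q F'"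
  by (simp add: cut_subquiver_def)

lemma edges_cut [simp]: "edges (cut_subquiver Q F) = F"
  by (simp add: cut_subquiver_def)

lemma verts_cut [simp]: "verts (cut_subquiver Q F) = verts Q"
  by (simp add: cut_subquiver_def)

lemma edges_contract [simp]: "edges (contract Q F) = edges Q - F"
  by (simp add: contract_def Let_def)

lemma contract_cut: "contract (cut_subquiver Q F) F' = cut_subquiver (contract Q F') (F - F')"
  by (simp add: contract_def Let_def cut_subquiver_def)

text \<open>A vertex of the double contraction is a set of components of the cut-subquiver with edge set \<open>A\<close>;
  the isomorphism sends it to its union.\<close>

lemma contract_contract_iso:
  assumes Q: "finite_quiver Q" and A: "A \<subseteq> edges Q" and B: "B \<subseteq> edges Q - A"
  shows "quiver_iso (contract (contract Q A) B) (contract Q (A \<union> B))"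
proof -
  let ?V = "verts Q"
  \<comment> \<open>\<open>c\<close> and \<open>d\<close> are the projections of \<open>Q\<close> onto its contractions by \<open>A\<close> and by \<open>A \<union> B\<close>,
    and \<open>q\<close> is the projection of the contraction by \<open>A\<close> onto the double contraction.\<close>
  define c where "c v = connectivity (cut_subquiver Q A) `` {v}" for v
  define d where "d v = connectivity (cut_subquiver Q (A \<union> B)) `` {v}" for v
  define q where "q C = connectivity (cut_subquiver (contract Q A) B) `` {C}" for C
  let ?a = "ends Q ` A" and ?b = "ends Q ` B"
  let ?r = "?a \<union> ?a\<inverse>" and ?s = "?b \<union> ?b\<inverse>"
  have "?a \<subseteq> ?V \<times> ?V" "?b \<subseteq> ?V \<times> ?V"
    using Q A B unfolding finite_quiver_def by blast+
  then have sub: "?r \<subseteq> ?V \<times> ?V" "?s \<subseteq> ?V \<times> ?V" by auto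
  have c_iff: "c u = c v \<longleftrightarrow> (u, v) \<in> ?r\<^sup>*" if "u \<in> ?V" "v \<in> ?V" for u v
    using that Image_connectivity_eq_iff[of u "cut_subquiver Q A" v]
    by (simp add: c_def connectivity_def adj_def cut_subquiver_def)
  have conn: "(u, v) \<in> connectivity (cut_subquiver Q (A \<union> B)) \<longleftrightarrow> u \<in> ?V \<and> v \<in> ?V \<and> (u, v) \<in> (?r \<union> ?s)\<^sup>*" for u v
    by (auto simp: connectivity_def adj_def cut_subquiver_def image_Un converse_Un Un_ac)
  have vc: "verts (contract Q A) = c ` ?V"
    by (simp add: contract_def Let_def components_eq c_def)
  have adjq: "adj (cut_subquiver (contract Q A) B) = map_prod c c ` ?b"
    by (simp add: adj_def cut_subquiver_def contract_def Let_def c_def[abs_def] image_image)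
  have connq: "(C, D) \<in> connectivity (cut_subquiver (contract Q A) B) \<longleftrightarrow>
      C \<in> c ` ?V \<and> D \<in> c ` ?V \<and> (C, D) \<in> (map_prod c c ` ?s)\<^sup>*" for C D
    unfolding connectivity_def adjq by (auto simp: vc image_Un converse_map_prod)
  have key: "(c u, c v) \<in> connectivity (cut_subquiver (contract Q A) B) \<longleftrightarrow>
      (u, v) \<in> connectivity (cut_subquiver Q (A \<union> B))" if "u \<in> ?V" "v \<in> ?V" for u v
    unfolding connq conn using rtrancl_quotient_iff[OF sub c_iff that] that by simp
  have c_mem: "v \<in> c v" "c v \<subseteq> ?V" if "v \<in> ?V" for v
    using that by (auto simp: c_def connectivity_def)
  have union: "\<Union> (q (c u)) = d u" if u: "u \<in> ?V" for u
  proof (intro subset_antisym subsetI)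
    fix x assume "x \<in> \<Union> (q (c u))"
    then obtain C where C: "x \<in> C" "(c u, C) \<in> connectivity (cut_subquiver (contract Q A) B)"
      unfolding q_def by blast
    then obtain v where v: "v \<in> ?V" "C = c v" unfolding connq by blast
    have x: "x \<in> ?V" using C v c_mem by blast
    have "c v = c x"
      using C(1) v x Image_connectivity_eq_iff[of v "cut_subquiver Q A" x] by (simp add: c_def)
    then show "x \<in> d u" using C v key[OF u x] by (simp add: d_def)
  next
    fix x assume "x \<in> d u"
    then have "(u, x) \<in> connectivity (cut_subquiver Q (A \<union> B))" by (simp add: d_def)
    moreover from this have x: "x \<in> ?V" by (simp add: conn)
    ultimately have "c x \<in> q (c u)" using key[OF u x] by (simp add: q_def)
    then show "x \<in> \<Union> (q (c u))" using c_mem(1)[OF x] by blast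
  qed
  have inj: "q (c u) = q (c v)" if "u \<in> ?V" "v \<in> ?V" "d u = d v" for u v
  proof -
    have "(u, v) \<in> connectivity (cut_subquiver Q (A \<union> B))"
      using that Image_connectivity_eq_iff[of u "cut_subquiver Q (A \<union> B)" v] by (simp add: d_def)
    then show ?thesis
      using key that Image_connectivity_eq_iff[of "c u" "cut_subquiver (contract Q A) B" "c v"]
      by (simp add: q_def vc)
  qed
  have v1: "verts (contract (contract Q A) B) = (\<lambda>v. q (c v)) ` ?V"
  proof -
    have "verts (contract (contract Q A) B) = q ` verts (contract Q A)"
      by (simp add: contract_def[of "contract Q A"] Let_def components_eq q_def)
    then show ?thesis by (simp add: vc image_image)
  qed
  have v2: "verts (contract Q (A \<union> B)) = d ` ?V"
    by (simp add: contract_def Let_def components_eq d_def)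
  show ?thesis
  proof (rule quiver_isoI[of Union _ _ id])
    have "inj_on Union ((\<lambda>v. q (c v)) ` ?V)"
    proof (rule inj_onI)
      fix x y assume "x \<in> (\<lambda>v. q (c v)) ` ?V" "y \<in> (\<lambda>v. q (c v)) ` ?V" "\<Union> x = \<Union> y"
      then obtain u v where "u \<in> ?V" "v \<in> ?V" "x = q (c u)" "y = q (c v)" "d u = d v"
        using union by (elim imageE) metis
      then show "x = y" using inj by blast
    qed
    moreover have "Union ` (\<lambda>v. q (c v)) ` ?V = d ` ?V"
      unfolding image_image by (rule image_cong) (simp_all add: union)
    ultimately show "bij_betw Union (verts (contract (contract Q A) B)) (verts (contract Q (A \<union> B)))"
      unfolding v1 v2 by (simp add: bij_betw_def)
    have "edges Q - A - B = edges Q - (A \<union> B)" by blast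
    then show "bij_betw id (edges (contract (contract Q A) B)) (edges (contract Q (A \<union> B)))"
      by simp
  next
    fix x assume "x \<in> edges (contract (contract Q A) B)"
    then have "ends Q x \<in> ?V \<times> ?V" using Q by (auto simp: finite_quiver_def)
    moreover have "ends (contract (contract Q A) B) x = map_prod q q (map_prod c c (ends Q x))"
      by (simp add: contract_def Let_def q_def[abs_def] c_def[abs_def])
    moreover have "ends (contract Q (A \<union> B)) x = map_prod d d (ends Q x)"
      by (simp add: contract_def Let_def d_def[abs_def])
    ultimately show "ends (contract Q (A \<union> B)) (id x) = map_prod Union Union (ends (contract (contract Q A) B) x)"
      using union by (cases "ends Q x") simp
    show "decor (contract Q (A \<union> B)) (id x) = decor (contract (contract Q A) B) x"
      by (simp add: contract_def Let_def)
  qed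
qed

lemma contract_empty_iso:
  assumes "finite_quiver Q"
  shows "quiver_iso Q (contract Q {})"
proof -
  have c: "connectivity (cut_subquiver Q {}) `` {v} = {v}" if "v \<in> verts Q" for v
    using that by (auto simp: connectivity_def adj_def)
  have "components (cut_subquiver Q {}) = (\<lambda>v. {v}) ` verts Q"
    unfolding components_eq by (intro image_cong) (simp_all add: c)
  moreover have "ends (contract Q {}) x = map_prod (\<lambda>v. {v}) (\<lambda>v. {v}) (ends Q x)" if "x \<in> edges Q" for x
  proof -
    have "ends Q x \<in> verts Q \<times> verts Q" using that assms by (auto simp: finite_quiver_def)
    then show ?thesis by (cases "ends Q x") (simp add: contract_def Let_def c)
  qed
  ultimately show ?thesis
    by (intro quiver_isoI[of "\<lambda>v. {v}" _ _ id]) (auto simp: contract_def Let_def bij_betw_def)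
qed

section \<open>Edge count on the localized monoid of isomorphism classes\<close>

lemma card_edges_rep: "finite_quiver Q \<Longrightarrow> card (edges (rep_qclass (iso_class Q))) = card (edges Q)"
  using rep_iso_class[of Q] by (auto simp: quiver_iso_def dest: bij_betw_same_card)

lemma card_edges_rep_add:
  "card (edges (rep_qclass (c + d))) = card (edges (rep_qclass c)) + card (edges (rep_qclass d))"
proof -
  have "card (edges (rep_qclass (c + d))) = card (edges (disj_union (rep_qclass c) (rep_qclass d)))"
    unfolding plus_qclass_def by (intro card_edges_rep finite_quiver_disj_union finite_rep_qclass)
  then show ?thesis
    using finite_rep_qclass[of c] finite_rep_qclass[of d] by (simp add: card_Plus finite_quiver_def)
qed

text \<open>The number of edges does not change under disjoint union with one-vertex quivers, so it is defined
  on the localization.\<close>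

lift_definition frac_edges :: "'k qfrac \<Rightarrow> nat" is "\<lambda>(G, n). card (edges (rep_qclass G))"
  by clarify (rule frac_invariant[where f = "\<lambda>G n. card (edges (rep_qclass G))"],
    auto simp: card_edges_rep_add edges_bullet)

lemma frac_edges_mk [simp]:
  "finite_quiver Q \<Longrightarrow> frac_edges (mk_qfrac (iso_class Q) n) = card (edges Q)"
  by transfer (simp add: card_edges_rep)

lemma frac_edges_add: "frac_edges (a + b) = frac_edges a + frac_edges b"
  by transfer (auto simp: card_edges_rep_add)

lemma frac_cases:
  obtains Q :: "(nat, nat, 'k) quiver" and n where "finite_quiver Q" "b = mk_qfrac (iso_class Q) n"
  using ex_mk_qfrac[of b] iso_class_rep finite_rep_qclass by metis

lemma iso_class_edgeless:
  fixes Q :: "('v, 'e, 'k) quiver"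
  assumes "finite_quiver Q" "edges Q = {}"
  shows "iso_class Q = bullets (card (verts Q))"
proof -
  have "iso_class Q = bullets n" if "finite_quiver Q" "edges Q = {}" "card (verts Q) = n"
    for n and Q :: "('v, 'e, 'k) quiver"
    using that
  proof (induction n arbitrary: Q)
    case 0
    then have "quiver_iso Q empty_quiver"
      by (auto simp: quiver_iso_def empty_quiver_def bij_betw_def finite_quiver_def)
    then show ?case
      unfolding zero_qclass_def bullets.simps using 0 by (intro iso_class_eqI finite_empty_quiver)
  next
    case (Suc n)
    have fin: "finite (verts Q)" using Suc.prems(1) by (simp add: finite_quiver_def)
    obtain v where v: "v \<in> verts Q" using Suc.prems(3) by fastforce
    define P where "P = Q\<lparr>verts := verts Q - {v}\<rparr>"
    have P: "finite_quiver P" "edges P = {}" "card (verts P) = n"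
      using Suc.prems v fin by (auto simp: P_def finite_quiver_def)
    have "bij_betw (case_sum (\<lambda>_. v) id) (verts (disj_union (bullet_quiver :: (unit, unit, 'k) quiver) P)) (verts Q)"
      using v by (intro bij_betw_byWitness[of _ "\<lambda>w. if w = v then Inl () else Inr w"])
        (auto simp: P_def bullet_quiver_def)
    moreover have "edges (disj_union (bullet_quiver :: (unit, unit, 'k) quiver) P) = {}"
      using P(2) by (auto simp: bullet_quiver_def)
    ultimately have "quiver_iso (disj_union (bullet_quiver :: (unit, unit, 'k) quiver) P) Q"
      using Suc.prems(2) unfolding quiver_iso_def by (metis bij_betw_empty1 bij_betw_empty2 bij_betw_def empty_iff image_empty inj_on_empty)
    then have "iso_class Q = iso_class (disj_union (bullet_quiver :: (unit, unit, 'k) quiver) P)"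
      using Suc.prems(1) P(1)
      by (intro iso_class_eqI[symmetric] finite_quiver_disj_union finite_bullet_quiver)
    also have "\<dots> = bullet + bullets n"
      using Suc.IH[OF P] P(1) by (simp add: iso_class_disj_union finite_bullet_quiver bullet_def)
    finally show ?case by simp
  qed
  then show ?thesis using assms by blast
qed

text \<open>A quiver without edges is a power of the one-vertex quiver, which is invertible.\<close>

lemma edgeless_invertible:
  assumes "frac_edges b = 0"
  obtains c where "b + c = 0"
proof -
  obtain Q :: "(nat, nat, 'a) quiver" and n where Q: "finite_quiver Q" "b = mk_qfrac (iso_class Q) n"
    by (rule frac_cases)
  then have "edges Q = {}" using assms by (auto simp: finite_quiver_def)
  then have "b + mk_qfrac (bullets n) (card (verts Q)) = mk_qfrac (bullets (card (verts Q) + n)) (card (verts Q) + n)"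
    using Q by (simp add: iso_class_edgeless frac_add bullets_add ac_simps)
  also have "\<dots> = 0"
    unfolding frac_zero[symmetric] frac_eq_iff by (intro exI[of _ 0]) simp
  finally show thesis by (rule that)
qed

section \<open>Convolution of functions on the basis\<close>

text \<open>Convolution of functions on the basis: the value at the quiver \<open>Q\<close>, with the exponent \<open>n\<close> of the
  inverse of \<open>bullet\<close>, is the sum of \<open>f H * g (Q/H)\<close> over the cut-subquivers \<open>H\<close> of \<open>Q\<close>, with the
  same exponent in both factors.\<close>

lift_definition frac_conv :: "('k qfrac \<Rightarrow> 'a::comm_ring_1) \<Rightarrow> ('k qfrac \<Rightarrow> 'a) \<Rightarrow> 'k qfrac \<Rightarrow> 'a" is
  "\<lambda>f g (G, n). sum_cuts (rep_qclass G) (\<lambda>h k. f (mk_qfrac h n) * g (mk_qfrac k n))"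
  by clarify (rule frac_invariant
      [where f = "\<lambda>G n. sum_cuts (rep_qclass G) (\<lambda>h k. f (mk_qfrac h n) * g (mk_qfrac k n))" for f g],
    auto simp: sum_cuts_rep_add sum_cuts_bullet frac_bullet)

lemma frac_conv_mk:
  assumes "finite_quiver Q"
  shows "frac_conv f g (mk_qfrac (iso_class Q) n) = (\<Sum>F\<in>Pow (edges Q).
    f (mk_qfrac (iso_class (cut_subquiver Q F)) n) * g (mk_qfrac (iso_class (contract Q F)) n))"
  by (subst mk_qfrac.abs_eq, subst frac_conv.abs_eq)
    (simp add: sum_cuts_rep[OF assms], simp add: sum_cuts_def)

text \<open>The counit on the basis, with values in an arbitrary commutative ring; it is the unit of \<open>frac_conv\<close>.\<close>

definition frac_unit :: "'k qfrac \<Rightarrow> 'a::comm_ring_1" where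
  "frac_unit b = (if frac_edges b = 0 then 1 else 0)"

lemma frac_conv_assoc: "frac_conv (frac_conv f g) h = frac_conv f (frac_conv g h)"
proof
  fix b :: "'a qfrac"
  obtain Q :: "(nat, nat, 'a) quiver" and n where Q: "finite_quiver Q" and b: "b = mk_qfrac (iso_class Q) n"
    by (rule frac_cases)
  let ?E = "edges Q" and ?c = "\<lambda>P. mk_qfrac (iso_class P) n"
  have fin: "finite ?E" using Q by (simp add: finite_quiver_def)
  then have finP: "finite (Pow A)" if "A \<subseteq> ?E" for A
    using that by (simp add: finite_subset)
  \<comment> \<open>Both sides are sums over pairs \<open>A \<subseteq> F\<close> of edge sets, or equally over disjoint pairs \<open>A\<close> and
    \<open>B = F - A\<close>.\<close>
  let ?t = "\<lambda>F A. f (?c (cut_subquiver Q A)) * g (?c (cut_subquiver (contract Q A) (F - A))) * h (?c (contract Q F))"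
  have "frac_conv (frac_conv f g) h b = (\<Sum>F\<in>Pow ?E. \<Sum>A\<in>Pow F. ?t F A)"
    unfolding b frac_conv_mk[OF Q]
    by (intro sum.cong refl)
      (simp add: frac_conv_mk finite_quiver_cut Q cut_cut contract_cut sum_distrib_right)
  also have "\<dots> = (\<Sum>(F, A)\<in>Sigma (Pow ?E) Pow. ?t F A)"
    by (intro sum.Sigma) (use fin finP in auto)
  also have "\<dots> = (\<Sum>(A, B)\<in>Sigma (Pow ?E) (\<lambda>A. Pow (?E - A)). ?t (A \<union> B) A)"
    by (rule sum.reindex_bij_witness[of _ "\<lambda>(A, B). (A \<union> B, A)" "\<lambda>(F, A). (A, F - A)"])
      (auto simp: Un_absorb1)
  also have "\<dots> = (\<Sum>A\<in>Pow ?E. \<Sum>B\<in>Pow (?E - A). ?t (A \<union> B) A)"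
    by (intro sum.Sigma[symmetric]) (use fin finP in auto)
  also have "\<dots> = (\<Sum>A\<in>Pow ?E. \<Sum>B\<in>Pow (?E - A). f (?c (cut_subquiver Q A)) *
      (g (?c (cut_subquiver (contract Q A) B)) * h (?c (contract (contract Q A) B))))"
  proof (intro sum.cong refl)
    fix A B assume AB: "A \<in> Pow ?E" "B \<in> Pow (?E - A)"
    then have "iso_class (contract (contract Q A) B) = iso_class (contract Q (A \<union> B))"
      by (intro iso_class_eqI contract_contract_iso finite_quiver_contract Q) auto
    moreover have "A \<union> B - A = B" using AB by auto
    ultimately show "?t (A \<union> B) A = f (?c (cut_subquiver Q A)) *
        (g (?c (cut_subquiver (contract Q A) B)) * h (?c (contract (contract Q A) B)))"
      by (simp add: mult.assoc)
  qed
  also have "\<dots> = frac_conv f (frac_conv g h) b"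
    unfolding b frac_conv_mk[OF Q]
    by (simp add: frac_conv_mk finite_quiver_contract Q sum_distrib_left)
  finally show "frac_conv (frac_conv f g) h b = frac_conv f (frac_conv g h) b" .
qed

lemma frac_conv_unit_left: "frac_conv frac_unit f = f"
proof
  fix b :: "'a qfrac"
  obtain Q :: "(nat, nat, 'a) quiver" and n where Q: "finite_quiver Q" and b: "b = mk_qfrac (iso_class Q) n"
    by (rule frac_cases)
  let ?E = "edges Q"
  have fin: "finite ?E" using Q by (simp add: finite_quiver_def)
  have iso: "iso_class (contract Q {}) = iso_class Q"
    by (intro iso_class_eqI[symmetric] contract_empty_iso finite_quiver_contract Q)
  have "frac_conv frac_unit f b =
      (\<Sum>F\<in>Pow ?E. if F = {} then f (mk_qfrac (iso_class (contract Q F)) n) else 0)"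
    unfolding b frac_conv_mk[OF Q]
  proof (intro sum.cong refl)
    fix F assume "F \<in> Pow ?E"
    moreover from this have "finite F" using fin by (auto intro: finite_subset)
    ultimately show "frac_unit (mk_qfrac (iso_class (cut_subquiver Q F)) n) * f (mk_qfrac (iso_class (contract Q F)) n) =
        (if F = {} then f (mk_qfrac (iso_class (contract Q F)) n) else 0)"
      by (simp add: frac_unit_def finite_quiver_cut Q)
  qed
  then show "frac_conv frac_unit f b = f b"
    using fin by (simp add: b iso)
qed

lemma frac_conv_unit_right: "frac_conv f frac_unit = f"
proof
  fix b :: "'a qfrac"
  obtain Q :: "(nat, nat, 'a) quiver" and n where Q: "finite_quiver Q" and b: "b = mk_qfrac (iso_class Q) n"
    by (rule frac_cases)
  let ?E = "edges Q"
  have fin: "finite ?E" using Q by (simp add: finite_quiver_def)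
  have "frac_conv f frac_unit b =
      (\<Sum>F\<in>Pow ?E. if F = ?E then f (mk_qfrac (iso_class (cut_subquiver Q F)) n) else 0)"
    unfolding b frac_conv_mk[OF Q]
    by (intro sum.cong refl) (use fin in \<open>auto simp: frac_unit_def finite_quiver_contract Q\<close>)
  then show "frac_conv f frac_unit b = f b"
    using fin by (simp add: b cut_subquiver_def)
qed

lemma frac_conv_hom:
  fixes h :: "'a::comm_ring_1 \<Rightarrow> 'b::comm_ring_1" and b :: "'k qfrac"
  assumes "h 0 = 0" and "\<And>x y. h (x + y) = h x + h y" and "\<And>x y. h (x * y) = h x * h y"
  shows "frac_conv (\<lambda>a. h (f a)) (\<lambda>a. h (g a)) b = h (frac_conv f g b)"
proof -
  obtain Q :: "(nat, nat, 'k) quiver" and n where Q: "finite_quiver Q" and b: "b = mk_qfrac (iso_class Q) n"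
    by (rule frac_cases)
  have "h (sum t A) = (\<Sum>x\<in>A. h (t x))" for t and A :: "nat set set"
    by (induction A rule: infinite_finite_induct) (simp_all add: assms)
  then show ?thesis unfolding b frac_conv_mk[OF Q] by (simp add: assms)
qed

section \<open>Convolution inverses of multiplicative functions\<close>

text \<open>Homomorphisms from the localized monoid of isomorphism classes to the multiplicative monoid of a
  commutative ring; their linear extensions are the characters.\<close>

definition multiplicative :: "('k qfrac \<Rightarrow> 'a::comm_ring_1) \<Rightarrow> bool" where
  "multiplicative f \<longleftrightarrow> f 0 = 1 \<and> (\<forall>a b. f (a + b) = f a * f b)"

lemma multiplicative_unit_edgeless:
  assumes "multiplicative g" "frac_edges b = 0"
  obtains u where "g b * u = 1"
  using edgeless_invertible[OF assms(2)] assms(1) unfolding multiplicative_def by metis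

text \<open>A chosen way to write a basis element as a quiver with an exponent of the inverse of \<open>bullet\<close>.\<close>

definition frac_rep :: "'k qfrac \<Rightarrow> (nat, nat, 'k) quiver \<times> nat" where
  "frac_rep b = (SOME p. finite_quiver (fst p) \<and> b = mk_qfrac (iso_class (fst p)) (snd p))"

lemma frac_rep:
  "finite_quiver (fst (frac_rep b))" "mk_qfrac (iso_class (fst (frac_rep b))) (snd (frac_rep b)) = b"
proof -
  obtain Q :: "(nat, nat, 'a) quiver" and n where "finite_quiver Q" "b = mk_qfrac (iso_class Q) n"
    by (rule frac_cases)
  then have "\<exists>p :: (nat, nat, 'a) quiver \<times> nat. finite_quiver (fst p) \<and> b = mk_qfrac (iso_class (fst p)) (snd p)"
    by (intro exI[of _ "(Q, n)"]) simp
  from someI_ex[OF this]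
  show "finite_quiver (fst (frac_rep b))" "mk_qfrac (iso_class (fst (frac_rep b))) (snd (frac_rep b)) = b"
    unfolding frac_rep_def[symmetric] by simp_all
qed

lemma frac_edges_rep: "frac_edges b = card (edges (fst (frac_rep b)))"
  using frac_edges_mk[OF frac_rep(1), of b "snd (frac_rep b)"] by (simp add: frac_rep(2))

text \<open>The equation \<open>f * g = frac_unit\<close> at the chosen quiver \<open>Q\<close>, solved for the term of the full
  cut-subquiver \<open>H = Q\<close>.  The last factor is the inverse of \<open>g (Q/Q)\<close>; its choice is meaningful when
  \<open>g\<close> is multiplicative, as \<open>Q/Q\<close> has no edges.\<close>

function left_inverse :: "('k qfrac \<Rightarrow> 'a::comm_ring_1) \<Rightarrow> 'k qfrac \<Rightarrow> 'a" where
  "left_inverse g b =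
    (frac_unit b - (\<Sum>F\<in>Pow (edges (fst (frac_rep b))) - {edges (fst (frac_rep b))}.
       left_inverse g (mk_qfrac (iso_class (cut_subquiver (fst (frac_rep b)) F)) (snd (frac_rep b))) *
       g (mk_qfrac (iso_class (contract (fst (frac_rep b)) F)) (snd (frac_rep b))))) *
    (SOME u. g (mk_qfrac (iso_class (contract (fst (frac_rep b)) (edges (fst (frac_rep b))))) (snd (frac_rep b))) * u = 1)"
  by pat_completeness auto
termination
proof (relation "measure (\<lambda>(g, b). frac_edges b)")
  fix g :: "'a qfrac \<Rightarrow> 'b::comm_ring_1" and b F
  let ?Q = "fst (frac_rep b)"
  assume "F \<in> Pow (edges ?Q) - {edges ?Q}"
  then have F: "F \<subset> edges ?Q" by auto
  have "finite (edges ?Q)" using frac_rep(1)[of b] by (simp add: finite_quiver_def)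
  then have "card F < card (edges ?Q)" using F by (rule psubset_card_mono)
  moreover have "finite_quiver (cut_subquiver ?Q F)"
    using F by (intro finite_quiver_cut frac_rep(1)) auto
  ultimately show "((g, mk_qfrac (iso_class (cut_subquiver ?Q F)) (snd (frac_rep b))), g, b) \<in> measure (\<lambda>(g, b). frac_edges b)"
    by (simp add: frac_edges_rep[of b])
qed simp

declare left_inverse.simps [simp del]

lemma frac_conv_left_inverse:
  fixes g :: "'k qfrac \<Rightarrow> 'a::comm_ring_1"
  assumes "multiplicative g"
  shows "frac_conv (left_inverse g) g = frac_unit"
proof
  fix b :: "'k qfrac"
  define Q where "Q = fst (frac_rep b)"
  define n where "n = snd (frac_rep b)"
  have Q: "finite_quiver Q" and b: "b = mk_qfrac (iso_class Q) n"
    unfolding Q_def n_def by (simp_all add: frac_rep)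
  let ?E = "edges Q"
  have fin: "finite ?E" using Q by (simp add: finite_quiver_def)
  let ?k = "\<lambda>F. g (mk_qfrac (iso_class (contract Q F)) n)"
  let ?t = "\<lambda>F. left_inverse g (mk_qfrac (iso_class (cut_subquiver Q F)) n) * ?k F"
  define u where "u = (SOME u. ?k ?E * u = 1)"
  have "\<exists>u. ?k ?E * u = 1"
    using multiplicative_unit_edgeless[OF assms, of "mk_qfrac (iso_class (contract Q ?E)) n"]
    by (auto simp: finite_quiver_contract Q)
  then have u: "?k ?E * u = 1" unfolding u_def by (rule someI_ex)
  have rec: "left_inverse g b = (frac_unit b - (\<Sum>F\<in>Pow ?E - {?E}. ?t F)) * u"
    by (subst left_inverse.simps) (simp only: Q_def[symmetric] n_def[symmetric] u_def)
  have "frac_conv (left_inverse g) g b = ?t ?E + (\<Sum>F\<in>Pow ?E - {?E}. ?t F)"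
    unfolding b frac_conv_mk[OF Q] using fin by (intro sum.remove) auto
  also have "?t ?E = left_inverse g b * ?k ?E"
    by (simp add: b cut_subquiver_def)
  also have "\<dots> = frac_unit b - (\<Sum>F\<in>Pow ?E - {?E}. ?t F)"
    unfolding rec using u by (simp add: mult.assoc mult.commute[of u])
  finally show "frac_conv (left_inverse g) g b = frac_unit b" by simp
qed

lemma frac_conv_add:
  fixes P Q :: "(nat, nat, 'k) quiver"
  assumes P: "finite_quiver P" and Q: "finite_quiver Q"
  shows "frac_conv f g (mk_qfrac (iso_class P) m + mk_qfrac (iso_class Q) n) =
    (\<Sum>(F, F')\<in>Pow (edges P) \<times> Pow (edges Q).
       f (mk_qfrac (iso_class (cut_subquiver P F)) m + mk_qfrac (iso_class (cut_subquiver Q F')) n) *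
       g (mk_qfrac (iso_class (contract P F)) m + mk_qfrac (iso_class (contract Q F')) n))"
proof -
  have "frac_conv f g (mk_qfrac (iso_class P) m + mk_qfrac (iso_class Q) n) =
      sum_cuts (disj_union P Q) (\<lambda>h k. f (mk_qfrac h (m + n)) * g (mk_qfrac k (m + n)))"
    by (simp add: frac_add assms finite_quiver_disj_union frac_conv_mk sum_cuts_def
        flip: iso_class_disj_union)
  then show ?thesis
    unfolding sum_cuts_disj_union[OF assms] by (simp add: sum_cuts_def frac_add sum.cartesian_product)
qed

text \<open>For the induction, \<open>frac_unit\<close> is multiplicative, so the sums for \<open>f * g\<close> at \<open>a + b\<close> and for the
  product of its values at \<open>a\<close> and \<open>b\<close> agree; by the induction hypothesis they agree term by term,
  except possibly in the term of the full cut-subquivers, which carries a unit as its second factor.\<close>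

lemma multiplicative_left_inverse:
  assumes g: "multiplicative g" and inv: "frac_conv f g = frac_unit"
  shows "multiplicative f"
  unfolding multiplicative_def
proof (intro conjI allI)
  have "frac_unit (0 :: 'a qfrac) = frac_conv f g (mk_qfrac (iso_class (empty_quiver :: (nat, nat, 'a) quiver)) 0)"
    by (simp add: inv frac_zero flip: zero_qclass_def)
  also have "\<dots> = f 0 * g 0"
    unfolding frac_conv_mk[OF finite_empty_quiver]
    by (simp add: edges_empty_quiver iso_class_no_edges[OF finite_empty_quiver] frac_zero
        flip: zero_qclass_def)
  finally show "f 0 = 1"
    using g frac_edges_add[of "0 :: 'a qfrac" 0] by (simp add: multiplicative_def frac_unit_def)
next
  fix a b :: "'a qfrac"
  show "f (a + b) = f a * f b"
  proof (induction "frac_edges a + frac_edges b" arbitrary: a b rule: less_induct)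
    case less
    obtain P :: "(nat, nat, 'a) quiver" and m where P: "finite_quiver P" and a: "a = mk_qfrac (iso_class P) m"
      by (rule frac_cases)
    obtain Q :: "(nat, nat, 'a) quiver" and n where Q: "finite_quiver Q" and b: "b = mk_qfrac (iso_class Q) n"
      by (rule frac_cases)
    let ?X = "Pow (edges P) \<times> Pow (edges Q)"
    define c c' k k' where cs: "c F = mk_qfrac (iso_class (cut_subquiver P F)) m"
      "c' F = mk_qfrac (iso_class (cut_subquiver Q F)) n"
      "k F = mk_qfrac (iso_class (contract P F)) m"
      "k' F = mk_qfrac (iso_class (contract Q F)) n" for F
    have fin: "finite (edges P)" "finite (edges Q)" using P Q by (auto simp: finite_quiver_def)
    have top: "c (edges P) = a" "c' (edges Q) = b" by (simp_all add: cs a b cut_subquiver_def)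
    let ?t = "\<lambda>(F, F'). (f (c F + c' F') - f (c F) * f (c' F')) * g (k F + k' F')"
    have "(frac_unit (a + b) :: 'b) = (\<Sum>(F, F')\<in>?X. f (c F + c' F') * g (k F + k' F'))"
      unfolding inv[symmetric] a b frac_conv_add[OF P Q] cs ..
    moreover have "(frac_unit a * frac_unit b :: 'b) = (\<Sum>(F, F')\<in>?X. f (c F) * f (c' F') * g (k F + k' F'))"
    proof -
      have "(frac_unit a * frac_unit b :: 'b) =
          (\<Sum>F\<in>Pow (edges P). f (c F) * g (k F)) * (\<Sum>F\<in>Pow (edges Q). f (c' F) * g (k' F))"
        unfolding inv[symmetric] a b frac_conv_mk[OF P] frac_conv_mk[OF Q] cs ..
      also have "\<dots> = (\<Sum>(F, F')\<in>?X. (f (c F) * g (k F)) * (f (c' F') * g (k' F')))"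
        by (simp only: sum_product sum.cartesian_product)
      also have "\<dots> = (\<Sum>(F, F')\<in>?X. f (c F) * f (c' F') * g (k F + k' F'))"
        using g by (intro sum.cong refl) (auto simp: multiplicative_def)
      finally show ?thesis .
    qed
    moreover have "(frac_unit (a + b) :: 'b) = frac_unit a * frac_unit b"
      by (simp add: frac_unit_def frac_edges_add)
    ultimately have "sum ?t ?X = 0"
      by (simp add: left_diff_distrib sum_subtractf case_prod_beta)
    moreover have "sum ?t ?X = sum ?t {(edges P, edges Q)}"
    proof (rule sum.mono_neutral_right)
      show "finite ?X" using fin by simp
      show "\<forall>p\<in>?X - {(edges P, edges Q)}. ?t p = 0"
      proof
        fix p assume "p \<in> ?X - {(edges P, edges Q)}"
        then obtain F F' where p: "p = (F, F')" and F: "F \<subseteq> edges P" "F' \<subseteq> edges Q"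
          "(F, F') \<noteq> (edges P, edges Q)" by auto
        then have "card F + card F' < card (edges P) + card (edges Q)"
          using fin by (metis add_le_less_mono add_less_le_mono card_mono psubsetI psubset_card_mono)
        then have "f (c F + c' F') = f (c F) * f (c' F')"
          using F P Q by (intro less) (simp add: cs a b finite_quiver_cut)
        then show "?t p = 0" by (simp add: p)
      qed
    qed auto
    ultimately have "(f (a + b) - f a * f b) * g (k (edges P) + k' (edges Q)) = 0"
      by (simp add: top)
    moreover have "frac_edges (k (edges P) + k' (edges Q)) = 0"
      by (simp add: frac_edges_add cs finite_quiver_contract P Q)
    then obtain u where "g (k (edges P) + k' (edges Q)) * u = 1"
      using multiplicative_unit_edgeless[OF g] by blast
    ultimately have "f (a + b) - f a * f b = 0"
      by (metis mult.assoc mult.right_neutral mult_zero_left)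
    then show ?case by simp
  qed
qed

lemma frac_conv_left_unique:
  assumes "frac_conv f g = frac_unit" "frac_conv g h = frac_unit"
  shows "f = h"
proof -
  have "f = frac_conv f (frac_conv g h)" by (simp add: assms frac_conv_unit_right)
  also have "\<dots> = frac_conv (frac_conv f g) h" by (simp only: frac_conv_assoc)
  also have "\<dots> = h" by (simp add: assms frac_conv_unit_left)
  finally show ?thesis .
qed

lemma multiplicative_inverse:
  assumes "multiplicative g"
  obtains f where "multiplicative f" "frac_conv f g = frac_unit" "frac_conv g f = frac_unit"
proof -
  let ?f = "left_inverse g"
  have f: "frac_conv ?f g = frac_unit" by (rule frac_conv_left_inverse[OF assms])
  have m: "multiplicative ?f" by (rule multiplicative_left_inverse[OF assms f])
  have f': "frac_conv (left_inverse ?f) ?f = frac_unit" by (rule frac_conv_left_inverse[OF m])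
  have "left_inverse ?f = g" by (rule frac_conv_left_unique[OF f' f])
  then have "frac_conv g ?f = frac_unit" using f' by simp
  with m f show thesis by (rule that)
qed

section \<open>Linear functions on the Hopf algebra\<close>

lemma convolution_single:
  assumes "vector_space s"
  shows "convolution s f g (Poly_Mapping.single b 1) =
    frac_conv (\<lambda>a. f (Poly_Mapping.single a 1)) (\<lambda>a. g (Poly_Mapping.single a 1)) b"
proof -
  let ?\<phi> = "\<lambda>(a, b). f (Poly_Mapping.single a 1) * g (Poly_Mapping.single b 1)"
  obtain Q :: "(nat, nat, 'a) quiver" and n where Q: "finite_quiver Q" and b: "b = mk_qfrac (iso_class Q) n"
    by (rule frac_cases)
  interpret L: Vector_Spaces.linear scale s "lin_ext s ?\<phi>" by (rule linear_lin_ext[OF assms])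
  show ?thesis
    unfolding convolution_def b comp_apply coproduct_single[OF Q] frac_conv_mk[OF Q] L.sum
    by (simp add: lin_ext_single[OF assms])
qed

lemma linear_convolution:
  assumes "vector_space s"
  shows "Vector_Spaces.linear scale s (convolution s f g)"
  unfolding convolution_def coproduct_def
  by (rule Vector_Spaces.linear_compose[OF linear_lin_ext[OF vector_space_scale] linear_lin_ext[OF assms]])

lemma counit_single_frac: "counit (Poly_Mapping.single b 1) = frac_unit b"
proof -
  obtain Q :: "(nat, nat, 'a) quiver" and n where Q: "finite_quiver Q" and b: "b = mk_qfrac (iso_class Q) n"
    by (rule frac_cases)
  then show ?thesis
    by (simp add: counit_single frac_unit_def finite_quiver_def)
qed

lemma linear_counit: "Vector_Spaces.linear scale (*) counit"
  unfolding counit_def by (rule linear_lin_ext[OF vector_space_mult])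

lemma linear_scale_counit: "Vector_Spaces.linear scale scale (\<lambda>x. scale (counit x) (1 :: 'k::field_char_0 hopf))"
proof -
  interpret V: vector_space "scale :: 'k \<Rightarrow> 'k hopf \<Rightarrow> 'k hopf" by (rule vector_space_scale)
  interpret C: Vector_Spaces.linear scale "(*)" "counit :: 'k hopf \<Rightarrow> 'k" by (rule linear_counit)
  show ?thesis
    unfolding Vector_Spaces.linear_iff
    by (intro conjI allI vector_space_scale) (simp_all only: C.add C.scale V.scale_left_distrib V.scale_scale)
qed

lemma convolution_eq_counit_iff:
  "convolution (*) f g = counit \<longleftrightarrow>
    frac_conv (\<lambda>a. f (Poly_Mapping.single a 1)) (\<lambda>a. g (Poly_Mapping.single a 1)) = frac_unit"
  (is "?L \<longleftrightarrow> ?R")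
proof
  show "?L \<Longrightarrow> ?R"
    by (metis (no_types, lifting) ext convolution_single[OF vector_space_mult] counit_single_frac)
  show "?R \<Longrightarrow> ?L"
    by (intro linear_eqI[OF linear_convolution[OF vector_space_mult] linear_counit])
      (simp add: convolution_single[OF vector_space_mult] counit_single_frac)
qed

lemma convolution_eq_scale_counit_iff:
  fixes f g :: "'k::field_char_0 hopf \<Rightarrow> 'k hopf"
  shows
  "convolution scale f g = (\<lambda>x. scale (counit x) 1) \<longleftrightarrow>
    frac_conv (\<lambda>a. f (Poly_Mapping.single a 1)) (\<lambda>a. g (Poly_Mapping.single a 1)) = frac_unit"
  (is "?L \<longleftrightarrow> ?R")
proof -
  have u: "scale (counit (Poly_Mapping.single b 1)) 1 = (frac_unit b :: 'k hopf)" for b :: "'k qfrac"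
    unfolding counit_single_frac frac_unit_def
    by (auto intro!: poly_mapping_eqI simp: lookup_scale)
  show ?thesis
  proof
    assume L: ?L
    show ?R
    proof
      fix b
      show "frac_conv (\<lambda>a. f (Poly_Mapping.single a 1)) (\<lambda>a. g (Poly_Mapping.single a 1)) b = frac_unit b"
        using fun_cong[OF L, of "Poly_Mapping.single b 1"]
        unfolding convolution_single[OF vector_space_scale] u .
    qed
  next
    assume R: ?R
    show ?L
    proof (rule linear_eqI[OF linear_convolution[OF vector_space_scale] linear_scale_counit])
      fix b
      show "convolution scale f g (Poly_Mapping.single b 1) = scale (counit (Poly_Mapping.single b 1)) 1"
        unfolding convolution_single[OF vector_space_scale] u R ..
    qed
  qed
qed

text \<open>The antipode is the linear extension of the inverse of the inclusion of the basis into the Hopf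
  algebra.\<close>

lemma is_antipode_antipode: "is_antipode (antipode :: 'k::field_char_0 hopf \<Rightarrow> 'k hopf)"
proof -
  let ?i = "\<lambda>a. Poly_Mapping.single a 1 :: 'k hopf"
  have "multiplicative ?i"
    by (simp add: multiplicative_def mult_single)
  then obtain f where f: "frac_conv f ?i = frac_unit" "frac_conv ?i f = frac_unit"
    by (rule multiplicative_inverse)
  have "is_antipode (lin_ext scale f)"
    unfolding is_antipode_def convolution_eq_scale_counit_iff id_apply lin_ext_single[OF vector_space_scale]
    by (intro conjI linear_lin_ext vector_space_scale f)
  moreover have "S = lin_ext scale f" if S: "is_antipode S" for S
  proof (rule linear_eqI)
    show "Vector_Spaces.linear scale scale S" using S by (simp add: is_antipode_def)
    show "Vector_Spaces.linear scale scale (lin_ext scale f)" by (rule linear_lin_ext[OF vector_space_scale])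
    have "frac_conv (\<lambda>a. S (?i a)) ?i = frac_unit"
      using S unfolding is_antipode_def convolution_eq_scale_counit_iff by simp
    from frac_conv_left_unique[OF this f(2)]
    show "S (?i b) = lin_ext scale f (?i b)" for b
      unfolding lin_ext_single[OF vector_space_scale] by (rule fun_cong)
  qed
  ultimately show ?thesis unfolding antipode_def by (rule theI)
qed

theorem proposition3p7:
  shows "Vector_Spaces.linear scale (*) (omega :: 'k::field_char_0 hopf \<Rightarrow> 'k) \<and>
    convolution (*) (omega :: 'k hopf \<Rightarrow> 'k) e_char = counit \<and>
    convolution (*) e_char (omega :: 'k hopf \<Rightarrow> 'k) = counit \<and>
    (omega :: 'k hopf \<Rightarrow> 'k) = e_char \<circ> antipode \<and>
    (\<forall>(G1 :: ('v, 'e, 'k) quiver) (G2 :: ('w, 'f, 'k) quiver).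
       finite_quiver G1 \<longrightarrow> finite_quiver G2 \<longrightarrow>
       omega (quiver_elem (disj_union G1 G2)) = omega (quiver_elem G1) * omega (quiver_elem G2)) \<and>
    omega (quiver_elem (empty_quiver :: (nat, nat, 'k) quiver)) = 1 \<and>
    is_character (omega :: 'k hopf \<Rightarrow> 'k)"
proof -
  let ?i = "\<lambda>a. Poly_Mapping.single a 1 :: 'k hopf"
  let ?e = "\<lambda>a. e_char (?i a)"
  have e: "Vector_Spaces.linear scale (*) (e_char :: 'k hopf \<Rightarrow> 'k)" "e_char (1 :: 'k hopf) = 1"
    "\<And>x y :: 'k hopf. e_char (x * y) = e_char x * e_char y"
    using e_char_is_character unfolding is_character_def by auto
  interpret e: Vector_Spaces.linear scale "(*)" "e_char :: 'k hopf \<Rightarrow> 'k" by (rule e(1))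
  have "multiplicative ?e"
    using e(2,3) by (simp add: multiplicative_def flip: single_one mult_single) (metis mult_1 mult_single)
  then obtain w where w: "multiplicative w" "frac_conv w ?e = frac_unit" "frac_conv ?e w = frac_unit"
    by (rule multiplicative_inverse)
  have uniq: "f = lin_ext (*) w" if "Vector_Spaces.linear scale (*) f" "convolution (*) f e_char = counit" for f
  proof (rule linear_eqI[OF that(1) linear_lin_ext[OF vector_space_mult]])
    show "f (?i b) = lin_ext (*) w (?i b)" for b
      using frac_conv_left_unique[OF that(2)[unfolded convolution_eq_counit_iff] w(3)]
      unfolding lin_ext_single[OF vector_space_mult] by (rule fun_cong)
  qed
  have lin: "Vector_Spaces.linear scale (*) (lin_ext (*) w :: 'k hopf \<Rightarrow> 'k)"
    by (rule linear_lin_ext[OF vector_space_mult])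
  have left: "convolution (*) (lin_ext (*) w) e_char = counit"
    and right: "convolution (*) e_char (lin_ext (*) w) = counit"
    unfolding convolution_eq_counit_iff lin_ext_single[OF vector_space_mult] by (rule w)+
  have omega: "omega = lin_ext (*) w"
    unfolding omega_def by (rule the_equality) (blast intro: lin left uniq)+
  have char: "is_character (omega :: 'k hopf \<Rightarrow> 'k)"
    unfolding is_character_def omega
  proof (intro conjI allI lin)
    have "lin_ext (*) w (Poly_Mapping.single 0 1 :: 'k hopf) = 1"
      unfolding lin_ext_single[OF vector_space_mult] using w(1) by (simp add: multiplicative_def)
    then show "lin_ext (*) w (1 :: 'k hopf) = 1" by (simp only: single_one)
    show "lin_ext (*) w (x * y) = lin_ext (*) w x * lin_ext (*) w y" for x y :: "'k hopf"
      using w(1) by (intro lin_ext_mult vector_space_mult) (auto simp: multiplicative_def)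
  qed
  have "convolution (*) (e_char \<circ> antipode) e_char = (counit :: 'k hopf \<Rightarrow> 'k)"
  proof -
    have S: "frac_conv (\<lambda>a. antipode (?i a)) ?i = frac_unit"
      using is_antipode_antipode[where 'k = 'k]
      unfolding is_antipode_def convolution_eq_scale_counit_iff by simp
    have "frac_conv (\<lambda>a. e_char (antipode (?i a))) ?e b = frac_unit b" for b
      unfolding frac_conv_hom[of e_char, OF e.zero e.add e(3)] S
      by (simp add: frac_unit_def e.zero e(2))
    then show ?thesis unfolding convolution_eq_counit_iff by auto
  qed
  moreover have "Vector_Spaces.linear scale (*) (e_char \<circ> antipode :: 'k hopf \<Rightarrow> 'k)"
    using is_antipode_antipode e(1) unfolding is_antipode_def by (blast intro: Vector_Spaces.linear_compose)
  ultimately have "e_char \<circ> antipode = lin_ext (*) w" by (intro uniq)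
  then have "omega = (e_char \<circ> antipode :: 'k hopf \<Rightarrow> 'k)" using omega by simp
  moreover have "omega (quiver_elem (disj_union G1 G2)) = omega (quiver_elem G1) * omega (quiver_elem G2)"
    if "finite_quiver G1" "finite_quiver G2"
    for G1 :: "('v, 'e, 'k) quiver" and G2 :: "('w, 'f, 'k) quiver"
    using char that by (simp add: quiver_elem_disj_union is_character_def)
  moreover have "omega (quiver_elem (empty_quiver :: (nat, nat, 'k) quiver)) = 1"
    using char by (simp add: quiver_elem_empty is_character_def)
  ultimately show ?thesis
    using char lin left right unfolding omega by blast
qed

end
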